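(* Let $G_1$ and $G_2$ be torsion-free nilpotent groups. If some connected Cayley graph of finite valency on $G_1$ is isomorphic (as a graph) to some Cayley graph on $G_2$, then $G_1 \cong G_2$.
   Context: For a group $G$ and a symmetric subset $S \subseteq G$ (i.e. $S = S^{-1}$), the Cayley graph $\mathrm{Cay}(G;S)$ has vertex set $G$, with $g$ adjacent to $gs$ for every $g \in G$ and $s \in S$. It is connected iff $S$ generates $G$, and has finite valency iff $S$ is finite. *)

theory Defs
  imports
    "HOL-Algebra.Generated_Groups"
    "Graph_Theory.Digraph_Isomorphism"
begin

section \<open>Torsion-free and nilpotent groups\<close>

definition torsion_free :: "('a, 'm) monoid_scheme \<Rightarrow> bool"
  where "torsion_free G \<longleftrightarrow>
    (\<forall>x \<in> carrier G. \<forall>n::nat. 0 < n \<longrightarrow> x [^]\<^bsub>G\<^esub> n = \<one>\<^bsub>G\<^esub> \<longrightarrow> x = \<one>\<^bsub>G\<^esub>)"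

text \<open>The index starts at 0, so that \<open>lower_central G n\<close> is usually written
  $\gamma_{n+1}(G)$.  Commutators follow the convention of \<^const>\<open>derived\<close>.\<close>

primrec lower_central :: "('a, 'm) monoid_scheme \<Rightarrow> nat \<Rightarrow> 'a set"
  where
    "lower_central G 0 = carrier G"
  | "lower_central G (Suc n) = generate G
       (\<Union>x \<in> lower_central G n. \<Union>y \<in> carrier G.
          {x \<otimes>\<^bsub>G\<^esub> y \<otimes>\<^bsub>G\<^esub> inv\<^bsub>G\<^esub> x \<otimes>\<^bsub>G\<^esub> inv\<^bsub>G\<^esub> y})"

definition nilpotent :: "('a, 'm) monoid_scheme \<Rightarrow> bool"
  where "nilpotent G \<longleftrightarrow> (\<exists>n. lower_central G n = {\<one>\<^bsub>G\<^esub>})"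


section \<open>Cayley graphs\<close>

definition symmetric_subset :: "('a, 'm) monoid_scheme \<Rightarrow> 'a set \<Rightarrow> bool"
  where "symmetric_subset G S \<longleftrightarrow> S \<subseteq> carrier G \<and> S = set_inv\<^bsub>G\<^esub> S"

text \<open>Graphs are represented as symmetric digraphs: an edge is a pair of opposite arcs.
  If \<open>S\<close> contains the identity, there is a loop at every vertex.\<close>

definition cayley_graph :: "('a, 'm) monoid_scheme \<Rightarrow> 'a set \<Rightarrow> ('a, 'a \<times> 'a) pre_digraph"
  where "cayley_graph G S =
    \<lparr>verts = carrier G, arcs = {(g, g \<otimes>\<^bsub>G\<^esub> s) | g s. g \<in> carrier G \<and> s \<in> S},
     tail = fst, head = snd\<rparr>"

text \<open>The library's \<^const>\<open>out_degree\<close> is a cardinality in \<^typ>\<open>nat\<close>, hence 0 at vertices of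
  infinite degree; finiteness has to be expressed through the arcs themselves.\<close>

definition finite_valency :: "('v, 'e) pre_digraph \<Rightarrow> bool"
  where "finite_valency \<Gamma> \<longleftrightarrow> (\<forall>v \<in> verts \<Gamma>. finite (out_arcs \<Gamma> v))"


section \<open>Basic facts\<close>

lemma cayley_graph_simps [simp]:
  "verts (cayley_graph G S) = carrier G"
  "arcs (cayley_graph G S) = {(g, g \<otimes>\<^bsub>G\<^esub> s) | g s. g \<in> carrier G \<and> s \<in> S}"
  "tail (cayley_graph G S) = fst"
  "head (cayley_graph G S) = snd"
  by (simp_all add: cayley_graph_def)

lemma arcs_ends_cayley_graph:
  "arcs_ends (cayley_graph G S) = {(g, g \<otimes>\<^bsub>G\<^esub> s) | g s. g \<in> carrier G \<and> s \<in> S}"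
  by (simp add: arcs_ends_conv)

context group
begin

lemma symmetric_subset_carrier: "symmetric_subset G S \<Longrightarrow> S \<subseteq> carrier G"
  by (simp only: symmetric_subset_def)

lemma symmetric_subset_inv: "symmetric_subset G S \<Longrightarrow> s \<in> S \<Longrightarrow> inv s \<in> S"
  unfolding symmetric_subset_def SET_INV_def by blast

lemma wf_digraph_cayley_graph:
  assumes "symmetric_subset G S" shows "wf_digraph (cayley_graph G S)"
  using symmetric_subset_carrier[OF assms] by unfold_locales auto

lemma symmetric_cayley_graph:
  assumes "symmetric_subset G S" shows "symmetric (cayley_graph G S)"
  unfolding symmetric_def arcs_ends_cayley_graph
proof (rule symI, clarsimp)
  fix g s assume gs: "g \<in> carrier G" "s \<in> S"
  have "s \<in> carrier G" using symmetric_subset_carrier[OF assms] gs by blast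
  then have "g = g \<otimes> s \<otimes> inv s" "g \<otimes> s \<in> carrier G"
    using gs by (simp_all add: m_assoc)
  then show "\<exists>s'. g = g \<otimes> s \<otimes> s' \<and> g \<otimes> s \<in> carrier G \<and> s' \<in> S"
    using symmetric_subset_inv[OF assms] gs by blast
qed

lemma finite_valency_cayley_graph:
  assumes "symmetric_subset G S"
  shows "finite_valency (cayley_graph G S) \<longleftrightarrow> finite S"
proof -
  have "finite (out_arcs (cayley_graph G S) g) \<longleftrightarrow> finite S" if g: "g \<in> carrier G" for g
  proof -
    have "out_arcs (cayley_graph G S) g = (\<lambda>s. (g, g \<otimes> s)) ` S"
      using g by (auto simp: out_arcs_def)
    moreover have "inj_on (\<lambda>s. (g, g \<otimes> s)) S"
      using g symmetric_subset_carrier[OF assms]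
      by (intro inj_onI) (metis Units_eq Units_l_cancel prod.inject subsetD)
    ultimately show ?thesis by (simp add: finite_image_iff)
  qed
  then show ?thesis unfolding finite_valency_def by auto
qed

lemma connected_cayley_graph:
  assumes "symmetric_subset G S"
  shows "Digraph_Component.connected (cayley_graph G S) \<longleftrightarrow> generate G S = carrier G"
proof -
  have S: "S \<subseteq> carrier G" by (rule symmetric_subset_carrier[OF assms])
  let ?C = "cayley_graph G S"
  interpret wf_digraph ?C by (rule wf_digraph_cayley_graph[OF assms])
  have eq: "arcs_ends (with_proj (mk_symmetric ?C)) = arcs_ends ?C"
    using symmetric_cayley_graph[OF assms]
    unfolding with_proj_simps parcs_mk_symmetric symmetric_def arcs_ends_conv sym_def
    by (auto simp del: cayley_graph_simps(2))
  have conn: "Digraph_Component.connected ?C \<longleftrightarrow> (\<forall>u\<in>carrier G. \<forall>v\<in>carrier G. u \<rightarrow>\<^sup>*\<^bsub>?C\<^esub> v)"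
    unfolding Digraph_Component.connected_def strongly_connected_def reachable_def eq
    by auto
  have step: "g \<rightarrow>\<^sup>*\<^bsub>?C\<^esub> (g \<otimes> h)" if h: "h \<in> generate G S" and g: "g \<in> carrier G" for g h
    using h g
  proof (induction arbitrary: g)
    case one then show ?case by simp
  next
    case (incl h)
    then have "(g, g \<otimes> h) \<in> arcs_ends ?C" unfolding arcs_ends_cayley_graph by blast
    then show ?case by blast
  next
    case (inv h)
    then have "(g, g \<otimes> inv h) \<in> arcs_ends ?C"
      unfolding arcs_ends_cayley_graph using symmetric_subset_inv[OF assms] by blast
    then show ?case by blast
  next
    case (eng h1 h2)
    have "h1 \<in> carrier G" "h2 \<in> carrier G"
      using eng.hyps generate_incl[OF S] by auto
    then show ?case
      using reachable_trans[OF eng.IH(1)[OF eng.prems] eng.IH(2)[of "g \<otimes> h1"]] eng.prems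
      by (simp add: m_assoc)
  qed
  have gen: "v \<in> generate G S" if "\<one> \<rightarrow>\<^sup>*\<^bsub>?C\<^esub> v" for v
    using that
  proof (induction rule: reachable_induct)
    case base show ?case by (rule generate.one)
  next
    case (step x y)
    then show ?case
      unfolding arcs_ends_cayley_graph by (auto intro: generate.eng generate.incl)
  qed
  show ?thesis
  proof
    assume "Digraph_Component.connected ?C"
    then show "generate G S = carrier G"
      using gen generate_incl[OF S] conn by auto
  next
    assume S_gen: "generate G S = carrier G"
    have "u \<rightarrow>\<^sup>*\<^bsub>?C\<^esub> v" if "u \<in> carrier G" "v \<in> carrier G" for u v
      using step[of "inv u \<otimes> v" u] that S_gen by (simp add: m_assoc[symmetric])
    then show "Digraph_Component.connected ?C" using conn by blast
  qed
qed

end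

lemma digraph_iso_cayley_graph:
  assumes "group G" "symmetric_subset G S" "group H" "symmetric_subset H T"
  shows "digraph_iso (cayley_graph G S) (cayley_graph H T) \<longleftrightarrow>
    (\<exists>f. bij_betw f (carrier G) (carrier H) \<and>
      (\<forall>u \<in> carrier G. \<forall>v \<in> carrier G.
        (u, v) \<in> arcs_ends (cayley_graph G S) \<longleftrightarrow> (f u, f v) \<in> arcs_ends (cayley_graph H T)))"
    (is "?L \<longleftrightarrow> ?R")
proof -
  let ?C = "cayley_graph G S" and ?D = "cayley_graph H T"
  have ends: "arcs_ends ?C = arcs ?C" "arcs_ends ?D = arcs ?D"
    by (simp_all add: arcs_ends_cayley_graph)
  have wf: "wf_digraph ?C" "wf_digraph ?D"
    using assms group.wf_digraph_cayley_graph by blast+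
  have sub: "arcs ?C \<subseteq> carrier G \<times> carrier G" "arcs ?D \<subseteq> carrier H \<times> carrier H"
    using wf_digraph.tail_in_verts[OF wf(1)] wf_digraph.head_in_verts[OF wf(1)]
      wf_digraph.tail_in_verts[OF wf(2)] wf_digraph.head_in_verts[OF wf(2)]
    by (force simp del: cayley_graph_simps(2))+
  show ?thesis
  proof
    assume ?L
    then obtain h where h: "pre_digraph.digraph_isomorphism ?C h" and D: "?D = app_iso h ?C"
      unfolding digraph_iso_def by blast
    let ?f = "iso_verts h"
    have arcs: "iso_arcs h (u, v) = (?f u, ?f v)" if "(u, v) \<in> arcs ?C" for u v
    proof -
      have "tail ?D = iso_tail h" "head ?D = iso_head h"
        by (simp_all add: D tail_app_iso head_app_iso del: cayley_graph_simps)
      then have "iso_tail h = fst" "iso_head h = snd" by simp_all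
      then show ?thesis
        using h that unfolding pre_digraph.digraph_isomorphism_def
        by (auto simp del: cayley_graph_simps(2) intro!: prod_eqI dest!: bspec)
    qed
    have inj: "inj_on ?f (carrier G)"
      using h unfolding pre_digraph.digraph_isomorphism_def by simp
    have "verts ?D = ?f ` verts ?C" "arcs ?D = iso_arcs h ` arcs ?C"
      by (simp_all add: D verts_app_iso arcs_app_iso del: cayley_graph_simps)
    then have vs: "carrier H = ?f ` carrier G" and as: "arcs ?D = iso_arcs h ` arcs ?C"
      by (simp_all del: cayley_graph_simps(2))
    have "(u, v) \<in> arcs ?C \<longleftrightarrow> (?f u, ?f v) \<in> arcs ?D"
      if "u \<in> carrier G" "v \<in> carrier G" for u v
    proof
      assume "(u, v) \<in> arcs ?C"
      then show "(?f u, ?f v) \<in> arcs ?D" unfolding as using arcs by (metis imageI)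
    next
      assume "(?f u, ?f v) \<in> arcs ?D"
      then obtain x y where xy: "(x, y) \<in> arcs ?C" "(?f u, ?f v) = iso_arcs h (x, y)"
        unfolding as by force
      then have "?f u = ?f x" "?f v = ?f y" using arcs by auto
      then show "(u, v) \<in> arcs ?C"
        using inj sub(1) xy(1) that by (metis SigmaD1 SigmaD2 inj_onD subsetD)
    qed
    then show ?R unfolding ends bij_betw_def using inj vs by blast
  next
    assume ?R
    then obtain f where f: "inj_on f (carrier G)" "f ` carrier G = carrier H"
      and adj: "\<And>u v. u \<in> carrier G \<Longrightarrow> v \<in> carrier G \<Longrightarrow>
        (u, v) \<in> arcs ?C \<longleftrightarrow> (f u, f v) \<in> arcs ?D"
      unfolding ends bij_betw_def by blast
    let ?h = "\<lparr>iso_verts = f, iso_arcs = map_prod f f, iso_head = snd, iso_tail = fst\<rparr>"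
    have "inj_on (map_prod f f) (arcs ?C)"
      using map_prod_inj_on[OF f(1) f(1)] sub(1) inj_on_subset by blast
    then have iso: "pre_digraph.digraph_isomorphism ?C ?h"
      unfolding pre_digraph.digraph_isomorphism_def using wf(1) f(1)
      by (auto simp del: cayley_graph_simps(2))
    have sup: "e \<in> map_prod f f ` arcs ?C" if e: "e \<in> arcs ?D" for e
    proof -
      obtain x y where xy: "e = (x, y)" by (cases e)
      have "x \<in> f ` carrier G" "y \<in> f ` carrier G" using e sub(2) unfolding f(2) xy by blast+
      then obtain u v where uv: "x = f u" "y = f v" "u \<in> carrier G" "v \<in> carrier G" by blast
      then have "(u, v) \<in> arcs ?C" using e adj[OF uv(3,4)] unfolding xy by blast
      then show ?thesis unfolding xy uv(1,2) by (rule rev_image_eqI) simp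
    qed
    have sub': "map_prod f f e \<in> arcs ?D" if e: "e \<in> arcs ?C" for e
    proof -
      obtain u v where uv: "e = (u, v)" by (cases e)
      have "u \<in> carrier G" "v \<in> carrier G" using e sub(1) unfolding uv by blast+
      then show ?thesis using e adj unfolding uv map_prod_simp by blast
    qed
    have "arcs ?D = map_prod f f ` arcs ?C"
      by (intro equalityI subsetI) (erule sup, erule imageE, simp only: sub')
    then have "?D = app_iso ?h ?C"
      using f(2) unfolding app_iso_def
      by (intro pre_digraph.equality) (simp_all del: cayley_graph_simps(2))
    then show ?L unfolding digraph_iso_def using iso by blast
  qed
qed

end

theory Submission
  imports Defs
begin

text \<open>A graph isomorphism \<open>\<phi>\<close> between the Cayley graphs with \<open>\<phi>(1) = 1\<close> is already a group
  homomorphism.  The key is that in a bi-ordered group an automorphism \<open>\<tau>\<close> of a Cayley graph whose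
  displacement \<open>f(x) = x\<^sup>-\<^sup>1 \<tau>(x)\<close> takes finitely many values is the translation by a central element.
  Indeed, if \<open>s\<close> is the largest element of the finite set \<open>S\<close>, then the lines \<open>n \<mapsto> x s\<^sup>n\<close> are unique
  geodesics, which forces \<open>f\<close> to be recurrent along them; comparing \<open>\<tau>\<close> with \<open>\<tau>\<^sup>-\<^sup>1\<close> in the order
  yields \<open>\<tau>(x s) = \<tau>(x) s\<close>.  Now \<open>\<tau>\<close> is also an automorphism of the Cayley graph of
  \<open>S - {s, s\<^sup>-\<^sup>1}\<close>, so that all of \<open>S\<close> is dealt with by induction.

  Torsion-free nilpotent groups are bi-orderable.  A central \<open>z\<close> of \<open>G\<close> acts with bounded
  displacement, hence so does its conjugate by \<open>\<phi>\<close>; thus \<open>\<phi>\<close> maps the center onto the center and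
  induces an isomorphism of Cayley graphs of the central quotients.  By induction on the class this
  is a homomorphism, and the error term of \<open>\<phi>\<close> is a central-valued function; it is constant because
  a nonempty finite subset of a torsion-free group has no nontrivial translation symmetry.\<close>

section \<open>Isomorphisms of Cayley graphs\<close>

text \<open>Adjacency is expressed through the label \<open>inv x \<otimes> y\<close> of the arc
  from \<open>x\<close> to \<open>y\<close>, so that composition, inversion and passage to quotients
  become computations with labels. For groups with symmetric \<open>S\<close> and \<open>T\<close>
  this is isomorphism of the two Cayley graphs.\<close>

definition cayley_iso ::
    "('a, 'm) monoid_scheme \<Rightarrow> 'a set \<Rightarrow> ('b, 'n) monoid_scheme \<Rightarrow> 'b set \<Rightarrow> ('a \<Rightarrow> 'b) \<Rightarrow> bool"
  where "cayley_iso G S H T \<phi> \<longleftrightarrow> bij_betw \<phi> (carrier G) (carrier H) \<and>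
    (\<forall>x \<in> carrier G. \<forall>y \<in> carrier G.
      inv\<^bsub>G\<^esub> x \<otimes>\<^bsub>G\<^esub> y \<in> S \<longleftrightarrow> inv\<^bsub>H\<^esub> (\<phi> x) \<otimes>\<^bsub>H\<^esub> \<phi> y \<in> T)"

lemma cayley_iso_closed: "cayley_iso G S H T \<phi> \<Longrightarrow> x \<in> carrier G \<Longrightarrow> \<phi> x \<in> carrier H"
  unfolding cayley_iso_def by (auto dest: bij_betwE)

lemma cayley_iso_edge:
  "cayley_iso G S H T \<phi> \<Longrightarrow> x \<in> carrier G \<Longrightarrow> y \<in> carrier G \<Longrightarrow>
    inv\<^bsub>G\<^esub> x \<otimes>\<^bsub>G\<^esub> y \<in> S \<longleftrightarrow> inv\<^bsub>H\<^esub> (\<phi> x) \<otimes>\<^bsub>H\<^esub> \<phi> y \<in> T"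
  unfolding cayley_iso_def by auto

lemma cayley_iso_inj:
  "cayley_iso G S H T \<phi> \<Longrightarrow> x \<in> carrier G \<Longrightarrow> y \<in> carrier G \<Longrightarrow> \<phi> x = \<phi> y \<Longrightarrow> x = y"
  unfolding cayley_iso_def bij_betw_def by (auto dest: inj_onD)

lemma cayley_iso_surj:
  assumes "cayley_iso G S H T \<phi>" "y \<in> carrier H"
  obtains x where "x \<in> carrier G" "y = \<phi> x"
proof -
  have "\<phi> ` carrier G = carrier H" using assms(1) by (simp add: cayley_iso_def bij_betw_def)
  with assms(2) show thesis by (metis imageE that)
qed

lemma cayley_iso_inv_into:
  assumes iso: "cayley_iso G S H T \<phi>"
  defines "\<psi> \<equiv> inv_into (carrier G) \<phi>"
  shows "cayley_iso H T G S \<psi>"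
    and "\<And>x. x \<in> carrier G \<Longrightarrow> \<psi> (\<phi> x) = x"
    and "\<And>y. y \<in> carrier H \<Longrightarrow> \<phi> (\<psi> y) = y"
proof -
  have bij: "bij_betw \<phi> (carrier G) (carrier H)" using iso by (simp add: cayley_iso_def)
  show l: "\<And>x. x \<in> carrier G \<Longrightarrow> \<psi> (\<phi> x) = x"
    and r: "\<And>y. y \<in> carrier H \<Longrightarrow> \<phi> (\<psi> y) = y"
    unfolding \<psi>_def using bij
    by (simp_all add: bij_betw_inv_into_left bij_betw_inv_into_right)
  have bij': "bij_betw \<psi> (carrier H) (carrier G)"
    unfolding \<psi>_def using bij by (rule bij_betw_inv_into)
  then have "\<psi> y \<in> carrier G" if "y \<in> carrier H" for y using that by (auto dest: bij_betwE)
  then show "cayley_iso H T G S \<psi>"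
    using bij' r cayley_iso_edge[OF iso] by (simp add: cayley_iso_def)
qed

lemma cayley_iso_comp:
  assumes "cayley_iso G S H T \<phi>" "cayley_iso H T K U \<psi>"
  shows "cayley_iso G S K U (\<lambda>x. \<psi> (\<phi> x))"
proof -
  have "bij_betw (\<psi> \<circ> \<phi>) (carrier G) (carrier K)"
    using assms unfolding cayley_iso_def by (blast intro: bij_betw_trans)
  then show ?thesis
    using cayley_iso_edge[OF assms(1)] cayley_iso_edge[OF assms(2)] cayley_iso_closed[OF assms(1)]
    by (simp add: cayley_iso_def o_def)
qed

context group
begin

lemma inv_mult_cancel_left [simp]:
  "x \<in> carrier G \<Longrightarrow> y \<in> carrier G \<Longrightarrow> inv x \<otimes> (x \<otimes> y) = y"
  "x \<in> carrier G \<Longrightarrow> y \<in> carrier G \<Longrightarrow> x \<otimes> (inv x \<otimes> y) = y"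
  by (simp_all add: m_assoc[symmetric])

lemma inv_mult_eq_iff:
  "x \<in> carrier G \<Longrightarrow> y \<in> carrier G \<Longrightarrow> e \<in> carrier G \<Longrightarrow> inv x \<otimes> y = e \<longleftrightarrow> y = x \<otimes> e"
  using inv_mult_cancel_left by metis

lemma symmetric_subsetI:
  assumes SG: "S \<subseteq> carrier G" and inv: "\<And>s. s \<in> S \<Longrightarrow> inv s \<in> S"
  shows "symmetric_subset G S"
proof -
  have "s = inv (inv s)" if "s \<in> S" for s using that SG by auto
  then show ?thesis unfolding symmetric_subset_def SET_INV_def using SG inv by blast
qed

lemma cayley_iso_left_mult:
  assumes a: "a \<in> carrier G"
  shows "cayley_iso G S G S (\<lambda>x. a \<otimes> x)"
proof -
  have "bij_betw (\<lambda>x. a \<otimes> x) (carrier G) (carrier G)"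
    by (rule bij_betw_byWitness[where f' = "\<lambda>x. inv a \<otimes> x"]) (use a in auto)
  then show ?thesis
    using a by (simp add: cayley_iso_def inv_mult_group m_assoc)
qed

text \<open>As \<open>S\<close> is symmetric, every element of the generated subgroup is the end of
  a path from \<open>\<one>\<close> in the Cayley graph; induction goes along such paths.\<close>

lemma generate_path_induct [consumes 3, case_names base step]:
  assumes S: "symmetric_subset G S" and gen: "generate G S = carrier G" and x: "x \<in> carrier G"
    and base: "Q \<one>" and step: "\<And>x s. x \<in> carrier G \<Longrightarrow> s \<in> S \<Longrightarrow> Q x \<Longrightarrow> Q (x \<otimes> s)"
  shows "Q x"
proof -
  note SG = symmetric_subset_carrier[OF S]
  \<comment> \<open>\<open>generate\<close> is closed under products of two arbitrary members, so
    the starting point \<open>y\<close> must be arbitrary for the two induction hypotheses to be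
    chained.\<close>
  have "\<forall>y \<in> carrier G. Q y \<longrightarrow> Q (y \<otimes> h)" if "h \<in> generate G S" for h
    using that
  proof induction
    case (inv h)
    then show ?case using step symmetric_subset_inv[OF S] by blast
  next
    case (eng h1 h2)
    then have "h1 \<in> carrier G" "h2 \<in> carrier G" using generate_incl[OF SG] by auto
    with eng.IH show ?case by (simp flip: m_assoc)
  qed (use step in auto)
  with base gen x show ?thesis by (metis l_one one_closed)
qed

end


section \<open>Bi-ordered groups\<close>

text \<open>\<open>P\<close> is the positive cone. Its invariance under conjugation,
  \<open>pos_conj\<close>, is what makes the left-invariant order obtained from it right-invariant
  as well.\<close>

locale bi_ordered_group = group G for G (structure) +
  fixes P
  assumes pos_carrier: "P \<subseteq> carrier G"
    and one_not_pos: "\<one> \<notin> P"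
    and pos_mult: "x \<in> P \<Longrightarrow> y \<in> P \<Longrightarrow> x \<otimes> y \<in> P"
    and pos_conj: "x \<in> P \<Longrightarrow> y \<in> carrier G \<Longrightarrow> inv y \<otimes> x \<otimes> y \<in> P"
    and pos_total: "x \<in> carrier G \<Longrightarrow> x \<noteq> \<one> \<Longrightarrow> x \<in> P \<or> inv x \<in> P"
begin

definition le :: "'a \<Rightarrow> 'a \<Rightarrow> bool" (infix \<open>\<preceq>\<close> 50)
  where "x \<preceq> y \<longleftrightarrow> x = y \<or> inv x \<otimes> y \<in> P"

lemma le_refl [simp]: "x \<preceq> x" by (simp add: le_def)

lemma le_trans:
  assumes "x \<preceq> y" "y \<preceq> z" "x \<in> carrier G" "y \<in> carrier G" "z \<in> carrier G" shows "x \<preceq> z"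
  using assms pos_mult[of "inv x \<otimes> y" "inv y \<otimes> z"] by (auto simp: le_def m_assoc)

lemma le_antisym:
  assumes "x \<in> carrier G" "y \<in> carrier G" "x \<preceq> y" "y \<preceq> x" shows "x = y"
  using assms pos_mult[of "inv x \<otimes> y" "inv y \<otimes> x"] one_not_pos by (auto simp: le_def m_assoc)

lemma le_total:
  assumes "x \<in> carrier G" "y \<in> carrier G" shows "x \<preceq> y \<or> y \<preceq> x"
proof (cases "inv x \<otimes> y = \<one>")
  case True
  then have "y = x" using assms by (metis inv_equality inv_inv l_inv inv_closed inv_comm)
  then show ?thesis by simp
next
  case False
  then show ?thesis
    using assms pos_total[of "inv x \<otimes> y"] by (auto simp: le_def inv_mult_group)
qed

lemma le_mult_left:
  "a \<in> carrier G \<Longrightarrow> x \<in> carrier G \<Longrightarrow> y \<in> carrier G \<Longrightarrow> x \<preceq> y \<Longrightarrow> a \<otimes> x \<preceq> a \<otimes> y"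
  by (auto simp: le_def inv_mult_group m_assoc)

lemma le_mult_right:
  assumes "a \<in> carrier G" "x \<in> carrier G" "y \<in> carrier G" "x \<preceq> y"
  shows "x \<otimes> a \<preceq> y \<otimes> a"
  using assms pos_conj[of "inv x \<otimes> y" a] by (auto simp: le_def inv_mult_group m_assoc)

lemma le_cancel_right:
  assumes "a \<in> carrier G" "x \<in> carrier G" "y \<in> carrier G" "x \<otimes> a \<preceq> y \<otimes> a"
  shows "x \<preceq> y"
  using le_mult_right[of "inv a" "x \<otimes> a" "y \<otimes> a"] assms by (simp add: m_assoc)

lemma finite_has_max:
  assumes "finite S" "S \<noteq> {}" "S \<subseteq> carrier G"
  obtains s where "s \<in> S" "\<And>t. t \<in> S \<Longrightarrow> t \<preceq> s"
proof -
  have "\<exists>s \<in> S. \<forall>t \<in> S. t \<preceq> s"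
    using assms
  proof (induction rule: finite_ne_induct)
    case (insert x F)
    then obtain s where s: "s \<in> F" "\<forall>t \<in> F. t \<preceq> s" by auto
    have c: "x \<in> carrier G" "s \<in> carrier G" "\<And>t. t \<in> F \<Longrightarrow> t \<in> carrier G"
      using insert.prems s by auto
    from le_total[OF c(1,2)] show ?case
    proof
      assume "s \<preceq> x"
      then have "\<forall>t \<in> insert x F. t \<preceq> x" using s c le_trans by (metis insertE le_refl)
      then show ?thesis by blast
    qed (use s in auto)
  qed auto
  then show thesis using that by blast
qed

section \<open>Comparing \<open>s^n g\<close> with \<open>g s^n\<close>\<close>

lemma mult_pow_le:
  assumes c: "s \<in> carrier G" "g \<in> carrier G" and le: "s \<otimes> g \<preceq> g \<otimes> s"
  shows "s [^] (n::nat) \<otimes> g \<preceq> g \<otimes> s [^] n"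
proof (induction n)
  case (Suc n)
  have "s [^] n \<otimes> (s \<otimes> g) \<preceq> s [^] n \<otimes> g \<otimes> s"
    using le_mult_left[OF _ _ _ le, of "s [^] n"] c by (simp add: m_assoc)
  moreover have "s [^] n \<otimes> g \<otimes> s \<preceq> g \<otimes> s [^] n \<otimes> s"
    by (rule le_mult_right) (use c Suc in auto)
  ultimately have "s [^] n \<otimes> (s \<otimes> g) \<preceq> g \<otimes> s [^] n \<otimes> s"
    by (rule le_trans) (use c in auto)
  then show ?case using c by (simp add: m_assoc)
qed (use c in simp)

lemma mult_pow_ge:
  assumes c: "s \<in> carrier G" "g \<in> carrier G" and le: "g \<otimes> s \<preceq> s \<otimes> g"
  shows "g \<otimes> s [^] (n::nat) \<preceq> s [^] n \<otimes> g"
proof (induction n)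
  case (Suc n)
  have "g \<otimes> s [^] n \<otimes> s \<preceq> s [^] n \<otimes> g \<otimes> s"
    by (rule le_mult_right) (use c Suc in auto)
  moreover have "s [^] n \<otimes> g \<otimes> s \<preceq> s [^] n \<otimes> (s \<otimes> g)"
    using le_mult_left[OF _ _ _ le, of "s [^] n"] c by (simp add: m_assoc)
  ultimately have "g \<otimes> s [^] n \<otimes> s \<preceq> s [^] n \<otimes> (s \<otimes> g)"
    by (rule le_trans) (use c in auto)
  then show ?case using c by (simp add: m_assoc)
qed (use c in simp)

text \<open>Otherwise the opposite inequality for \<open>s\<close> propagates to the exponent
  \<open>n - 1\<close>; chained with the hypothesis and after cancelling \<open>s^(n - 1)\<close> on
  the left, it returns the inequality that was denied.\<close>

lemma mult_le_of_pow_le: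
  assumes c: "s \<in> carrier G" "g \<in> carrier G" and n: "0 < (n::nat)"
    and le: "s [^] n \<otimes> g \<preceq> g \<otimes> s [^] n"
  shows "s \<otimes> g \<preceq> g \<otimes> s"
proof (rule ccontr)
  assume neg: "\<not> s \<otimes> g \<preceq> g \<otimes> s"
  then have ge: "g \<otimes> s \<preceq> s \<otimes> g" using le_total[of "s \<otimes> g" "g \<otimes> s"] c by auto
  obtain m where m: "n = Suc m" using n gr0_conv_Suc by blast
  have "s [^] n \<otimes> g \<preceq> g \<otimes> s [^] m \<otimes> s" using le c by (simp add: m m_assoc)
  moreover have "g \<otimes> s [^] m \<otimes> s \<preceq> s [^] m \<otimes> g \<otimes> s"
    by (rule le_mult_right) (use c mult_pow_ge[OF c ge] in auto)
  ultimately have "s [^] n \<otimes> g \<preceq> s [^] m \<otimes> g \<otimes> s"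
    by (rule le_trans) (use c in auto)
  then have "inv (s [^] m) \<otimes> (s [^] n \<otimes> g) \<preceq> inv (s [^] m) \<otimes> (s [^] m \<otimes> g \<otimes> s)"
    by (intro le_mult_left) (use c in auto)
  then show False using neg c by (simp add: m m_assoc)
qed

text \<open>The previous lemma yields one inequality for \<open>g\<close>. The element
  \<open>s^n\<close> commutes with \<open>inv g\<close> too, and the resulting inequality,
  multiplied by \<open>g\<close> on both sides, is the reverse one.\<close>

lemma pow_commute_imp_commute:
  assumes c: "s \<in> carrier G" "g \<in> carrier G" and n: "0 < (n::nat)"
    and eq: "s [^] n \<otimes> g = g \<otimes> s [^] n"
  shows "s \<otimes> g = g \<otimes> s"
proof (rule ccontr)
  assume "s \<otimes> g \<noteq> g \<otimes> s"
  have le: "s \<otimes> g \<preceq> g \<otimes> s" by (rule mult_le_of_pow_le[OF c n]) (simp add: eq)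
  have eq': "s [^] n \<otimes> inv g = inv g \<otimes> s [^] n"
  proof -
    have "inv g \<otimes> (s [^] n \<otimes> g) \<otimes> inv g = inv g \<otimes> (g \<otimes> s [^] n) \<otimes> inv g" by (simp only: eq)
    then show ?thesis using c by (simp add: m_assoc)
  qed
  have "s \<otimes> inv g \<preceq> inv g \<otimes> s" by (rule mult_le_of_pow_le[OF _ _ n]) (use c eq' in auto)
  then have "g \<otimes> (s \<otimes> inv g) \<otimes> g \<preceq> g \<otimes> (inv g \<otimes> s) \<otimes> g"
    by (intro le_mult_left le_mult_right) (use c in auto)
  then have "g \<otimes> s \<preceq> s \<otimes> g" using c by (simp add: m_assoc)
  with le have "s \<otimes> g = g \<otimes> s" using c by (intro le_antisym) auto
  with \<open>s \<otimes> g \<noteq> g \<otimes> s\<close> show False ..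
qed


section \<open>Bounded automorphisms of a Cayley graph of a bi-ordered group\<close>

text \<open>Each step contributes a factor of at most \<open>s\<close>, and invariance on both sides
  lets these bounds accumulate. The offset \<open>n\<close> makes the bound available for final
  segments of a path.\<close>

lemma path_le:
  assumes s: "s \<in> carrier G" "S \<subseteq> carrier G" "\<And>t. t \<in> S \<Longrightarrow> t \<preceq> s"
    and y: "\<And>i. i \<le> n + m \<Longrightarrow> y i \<in> carrier G" "\<And>i. i < n + m \<Longrightarrow> inv (y i) \<otimes> y (Suc i) \<in> S"
  shows "y (n + m) \<preceq> y n \<otimes> s [^] (m::nat)"
  using y
proof (induction m)
  case (Suc m)
  let ?t = "inv (y (n + m)) \<otimes> y (Suc (n + m))"
  have c: "y n \<in> carrier G" "y (n + m) \<in> carrier G" "y (Suc (n + m)) \<in> carrier G" using Suc.prems by auto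
  have "y (n + m) \<otimes> ?t \<preceq> y (n + m) \<otimes> s"
    by (rule le_mult_left) (use c s Suc.prems in auto)
  moreover have "y (n + m) \<otimes> s \<preceq> y n \<otimes> s [^] m \<otimes> s"
    by (rule le_mult_right) (use c s Suc in auto)
  ultimately have "y (n + m) \<otimes> ?t \<preceq> y n \<otimes> s [^] m \<otimes> s"
    by (rule le_trans) (use c s in auto)
  then show ?case using c s by (simp add: m_assoc)
qed simp

text \<open>At index \<open>i\<close>, \<open>path_le\<close> on the initial segment bounds
  \<open>y i\<close> from above; on the final segment it bounds \<open>y n\<close> by
  \<open>y i \<otimes> s [^] (n - i)\<close>, which after cancellation bounds \<open>y i\<close>
  from below.\<close>

lemma unique_geodesic:
  assumes s: "s \<in> carrier G" "S \<subseteq> carrier G" "\<And>t. t \<in> S \<Longrightarrow> t \<preceq> s"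
    and y: "\<And>i. i \<le> n \<Longrightarrow> y i \<in> carrier G" "\<And>i. i < n \<Longrightarrow> inv (y i) \<otimes> y (Suc i) \<in> S"
    and ends: "y n = y 0 \<otimes> s [^] (n::nat)" and i: "i \<le> n"
  shows "y i = y 0 \<otimes> s [^] i"
proof -
  have c: "y 0 \<in> carrier G" "y i \<in> carrier G" using y(1) i by auto
  have "y (0 + i) \<preceq> y 0 \<otimes> s [^] i" by (rule path_le[OF s]) (use y i in auto)
  moreover have "y (i + (n - i)) \<preceq> y i \<otimes> s [^] (n - i)" by (rule path_le[OF s]) (use y i in auto)
  then have "(y 0 \<otimes> s [^] i) \<otimes> s [^] (n - i) \<preceq> y i \<otimes> s [^] (n - i)"
    using i ends c s by (simp add: m_assoc nat_pow_mult)
  then have "y 0 \<otimes> s [^] i \<preceq> y i" by (rule le_cancel_right[rotated 3]) (use c s in auto)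
  ultimately show ?thesis using c s by (intro le_antisym) auto
qed

text \<open>Being the only path of its length between its ends is a property of the graph, so it
  survives the isomorphism: the path is pulled back along the inverse of
  \<open>\<phi>\<close>.\<close>

lemma unique_geodesic_image:
  assumes iso: "cayley_iso G S H T \<phi>"
    and s: "s \<in> carrier G" "S \<subseteq> carrier G" "\<And>t. t \<in> S \<Longrightarrow> t \<preceq> s" and z: "z \<in> carrier G"
    and y: "\<And>i. i \<le> n \<Longrightarrow> y i \<in> carrier H"
      "\<And>i. i < n \<Longrightarrow> inv\<^bsub>H\<^esub> (y i) \<otimes>\<^bsub>H\<^esub> y (Suc i) \<in> T"
    and ends: "y 0 = \<phi> z" "y n = \<phi> (z \<otimes> s [^] (n::nat))" and i: "i \<le> n"
  shows "y i = \<phi> (z \<otimes> s [^] i)"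
proof -
  define \<psi> where "\<psi> = inv_into (carrier G) \<phi>"
  note \<psi> = cayley_iso_inv_into[OF iso, folded \<psi>_def]
  have "\<psi> (y i) = \<psi> (y 0) \<otimes> s [^] i"
  proof (rule unique_geodesic[OF s _ _ _ i])
    show "\<psi> (y i) \<in> carrier G" if "i \<le> n" for i using cayley_iso_closed[OF \<psi>(1)] y(1) that by blast
    show "inv \<psi> (y i) \<otimes> \<psi> (y (Suc i)) \<in> S" if "i < n" for i
      using cayley_iso_edge[OF \<psi>(1)] y that by (metis Suc_leI less_imp_le)
    show "\<psi> (y n) = \<psi> (y 0) \<otimes> s [^] n" using ends \<psi>(2) z s by simp
  qed
  then show ?thesis using \<psi>(2,3) ends y(1) i z by metis
qed

text \<open>By pigeonhole, some \<open>n < m\<close> give the same displacements at \<open>x s\<^sup>-\<^sup>n\<close>, \<open>x s\<^sup>-\<^sup>m\<close> and at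
  \<open>x s\<^sup>n\<close>, \<open>x s\<^sup>m\<close>.  With \<open>j = m - n\<close>, the image under \<open>\<tau>\<close> of the line through \<open>x\<close>, followed up to
  \<open>\<tau>(x s\<^sup>-\<^sup>n)\<close> and continued by its left translate by \<open>x s\<^sup>j x\<^sup>-\<^sup>1\<close>, is then a path from
  \<open>\<tau>(x s\<^sup>-\<^sup>m)\<close> to \<open>\<tau>(x s\<^sup>m)\<close> of minimal length, so it agrees with the image of the line.\<close>

lemma displacement_recurs:
  assumes iso: "cayley_iso G S G S \<tau>" and sS: "s \<in> S"
    and s: "s \<in> carrier G" "S \<subseteq> carrier G" "\<And>t. t \<in> S \<Longrightarrow> t \<preceq> s"
    and bdd: "finite ((\<lambda>x. inv x \<otimes> \<tau> x) ` carrier G)" and x: "x \<in> carrier G"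
  obtains j :: nat where "0 < j" "\<tau> (x \<otimes> s [^] j) = x \<otimes> s [^] j \<otimes> (inv x \<otimes> \<tau> x)"
proof -
  define f where "f = (\<lambda>x. inv x \<otimes> \<tau> x)"
  note \<tau>c = cayley_iso_closed[OF iso]
  let ?F = "\<lambda>n::nat. (f (x \<otimes> inv (s [^] n)), f (x \<otimes> s [^] n))"
  have "finite (range ?F)"
    by (rule finite_subset[of _ "f ` carrier G \<times> f ` carrier G"])
      (use x s bdd in \<open>auto simp: f_def\<close>)
  then have "\<not> inj ?F" using finite_imageD infinite_UNIV_nat by blast
  then obtain n m where nm: "n < m" "?F n = ?F m"
    unfolding inj_def by (metis linorder_neqE_nat)
  \<comment> \<open>\<open>z\<close> is the initial point \<open>x s^-m\<close> of the segment.
    \<open>h\<close> is the left translation that pushes the line through \<open>x\<close> forward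
    by \<open>j\<close> steps, see \<open>hz\<close>.\<close>
  define z j h where "z = x \<otimes> inv (s [^] m)" and "j = m - n" and "h = x \<otimes> s [^] j \<otimes> inv x"
  have c: "z \<in> carrier G" "h \<in> carrier G" using x s by (auto simp: z_def h_def)
  have jm: "j + n = m" "0 < j" using nm by (auto simp: j_def)
  have zm: "z \<otimes> s [^] m = x" using x s by (simp add: z_def m_assoc)
  have zmk: "z \<otimes> s [^] (m + k) = x \<otimes> s [^] k" for k
    using c s by (simp add: zm[symmetric] m_assoc nat_pow_mult)
  have zj: "z \<otimes> s [^] j = x \<otimes> inv (s [^] n)"
  proof -
    have "s [^] j \<otimes> s [^] n = s [^] m" using s by (simp add: nat_pow_mult jm)
    then have "x = z \<otimes> s [^] j \<otimes> s [^] n" using zm c s by (simp add: m_assoc)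
    then show ?thesis using c s by (simp add: m_assoc)
  qed
  have hz: "h \<otimes> (z \<otimes> s [^] k) = z \<otimes> s [^] (j + k)" for k
  proof -
    have "z \<otimes> s [^] j \<otimes> inv z = h"
    proof -
      have "s [^] m \<otimes> s [^] j \<otimes> inv (s [^] m) = s [^] j"
        using s by (simp add: nat_pow_comm[of s m j] m_assoc)
      then have "z \<otimes> (s [^] m \<otimes> s [^] j \<otimes> inv (s [^] m)) \<otimes> inv z = z \<otimes> s [^] j \<otimes> inv z" by simp
      moreover have "z \<otimes> (s [^] m \<otimes> s [^] j \<otimes> inv (s [^] m)) \<otimes> inv z
          = (z \<otimes> s [^] m) \<otimes> s [^] j \<otimes> inv (z \<otimes> s [^] m)"
        using c s by (simp add: m_assoc inv_mult_group)
      ultimately show ?thesis by (simp add: zm h_def)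
    qed
    then have "h \<otimes> (z \<otimes> s [^] k) = z \<otimes> s [^] j \<otimes> inv z \<otimes> (z \<otimes> s [^] k)" by simp
    also have "\<dots> = z \<otimes> s [^] (j + k)" using c s by (simp add: m_assoc nat_pow_mult[symmetric])
    finally show ?thesis .
  qed
  have \<tau>f: "\<tau> w = w \<otimes> f w" if "w \<in> carrier G" for w using that \<tau>c by (simp add: f_def)
  have fc: "f w \<in> carrier G" if "w \<in> carrier G" for w using that \<tau>c by (simp add: f_def)
  define N where "N = m + m"
  \<comment> \<open>The branches agree at \<open>i = j\<close>: this is \<open>glue\<close>, which
    comes from the equal displacements at \<open>x s^-n\<close> and \<open>x s^-m\<close>.\<close>
  define y where "y = (\<lambda>i. if i \<le> j then \<tau> (z \<otimes> s [^] i) else h \<otimes> \<tau> (z \<otimes> s [^] (i - j)))"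
  have glue: "\<tau> (z \<otimes> s [^] j) = h \<otimes> \<tau> z"
  proof -
    have "\<tau> (z \<otimes> s [^] j) = z \<otimes> s [^] j \<otimes> f (z \<otimes> s [^] j)" using \<tau>f c s by simp
    also have "f (z \<otimes> s [^] j) = f z" using nm(2) by (simp add: zj) (simp add: z_def)
    also have "z \<otimes> s [^] j \<otimes> f z = h \<otimes> z \<otimes> f z" using hz[of 0] c by simp
    also have "\<dots> = h \<otimes> \<tau> z" using \<tau>f[of z] c fc by (simp add: m_assoc)
    finally show ?thesis .
  qed
  have y_late: "y i = h \<otimes> \<tau> (z \<otimes> s [^] (i - j))" if "j \<le> i" for i
    using that glue c by (cases "i = j") (auto simp: y_def)
  have edge: "inv (\<tau> (z \<otimes> s [^] i)) \<otimes> \<tau> (z \<otimes> s [^] Suc i) \<in> S" for i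
  proof -
    have "inv (z \<otimes> s [^] i) \<otimes> (z \<otimes> s [^] Suc i) = s"
      using c s by (simp add: inv_mult_group m_assoc)
    then show ?thesis using cayley_iso_edge[OF iso, of "z \<otimes> s [^] i" "z \<otimes> s [^] Suc i"] c s sS by simp
  qed
  \<comment> \<open>Index \<open>m + j\<close> is the point \<open>x s^j\<close> of the line, while
    the second branch of \<open>y\<close> has the value \<open>h \<otimes> \<tau> x\<close>
    there.\<close>
  have "y (m + j) = \<tau> (z \<otimes> s [^] (m + j))"
  proof (rule unique_geodesic_image[OF iso s c(1), of N])
    show "y i \<in> carrier G" for i using c s \<tau>c by (auto simp: y_def)
    show "inv (y i) \<otimes> y (Suc i) \<in> S" for i
    proof (cases "i < j")
      case True
      then show ?thesis using edge[of i] by (simp add: y_def)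
    next
      case False
      then have "y i = h \<otimes> \<tau> (z \<otimes> s [^] (i - j))" "y (Suc i) = h \<otimes> \<tau> (z \<otimes> s [^] Suc (i - j))"
        using y_late[of i] y_late[of "Suc i"] by (simp_all add: Suc_diff_le)
      then show ?thesis using edge[of "i - j"] c s \<tau>c by (simp add: inv_mult_group m_assoc)
    qed
    show "y 0 = \<tau> z" using c by (simp add: y_def)
    \<comment> \<open>The other end uses the equal displacements at \<open>x s^n\<close> and
      \<open>x s^m\<close>: since \<open>h\<close> carries \<open>x s^n\<close> to
      \<open>x s^m\<close>, it also carries \<open>\<tau>\<close> of the one to
      \<open>\<tau>\<close> of the other.\<close>
    have "N - j = m + n" using jm by (simp add: N_def)
    then have "y N = h \<otimes> \<tau> (x \<otimes> s [^] n)" using y_late[of N] jm zmk[of n] by (simp add: N_def)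
    also have "\<dots> = h \<otimes> (x \<otimes> s [^] n) \<otimes> f (x \<otimes> s [^] n)"
      using \<tau>f[of "x \<otimes> s [^] n"] fc x s c by (simp add: m_assoc)
    also have "h \<otimes> (x \<otimes> s [^] n) = x \<otimes> s [^] m"
    proof -
      have e: "j + (m + n) = m + m" using jm by simp
      show ?thesis using hz[of "m + n", unfolded e] zmk[of n] zmk[of m] by simp
    qed
    also have "f (x \<otimes> s [^] n) = f (x \<otimes> s [^] m)" using nm(2) by simp
    also have "x \<otimes> s [^] m \<otimes> f (x \<otimes> s [^] m) = \<tau> (z \<otimes> s [^] N)"
      using \<tau>f[of "x \<otimes> s [^] m"] x s zmk[of m] by (simp add: N_def)
    finally show "y N = \<tau> (z \<otimes> s [^] N)" .
    show "m + j \<le> N" using jm by (simp add: N_def)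
  qed
  then have "\<tau> (x \<otimes> s [^] j) = h \<otimes> \<tau> x" using y_late[of "m + j"] by (simp add: zmk zm)
  also have "\<dots> = x \<otimes> s [^] j \<otimes> (inv x \<otimes> \<tau> x)" using x s \<tau>c by (simp add: h_def m_assoc)
  finally show thesis using that jm by blast
qed

text \<open>Let \<open>g\<close> be the displacement at \<open>x\<close> and \<open>j\<close> a
  recurrence time. The image of the line from \<open>x\<close> to \<open>x s^j\<close> is a path of
  length \<open>j\<close>, so \<open>path_le\<close> gives \<open>x s^j g \<preceq> x g s^j\<close>;
  cancel \<open>x\<close> and apply \<open>mult_le_of_pow_le\<close>.\<close>

lemma bounded_displacement_le:
  assumes iso: "cayley_iso G S G S \<tau>" and sS: "s \<in> S"
    and s: "s \<in> carrier G" "S \<subseteq> carrier G" "\<And>t. t \<in> S \<Longrightarrow> t \<preceq> s"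
    and bdd: "finite ((\<lambda>x. inv x \<otimes> \<tau> x) ` carrier G)" and x: "x \<in> carrier G"
  shows "s \<otimes> (inv x \<otimes> \<tau> x) \<preceq> (inv x \<otimes> \<tau> x) \<otimes> s"
proof -
  let ?g = "inv x \<otimes> \<tau> x"
  note \<tau>c = cayley_iso_closed[OF iso]
  obtain j :: nat where j: "0 < j" "\<tau> (x \<otimes> s [^] j) = x \<otimes> s [^] j \<otimes> ?g"
    using displacement_recurs[OF iso sS s bdd x] by blast
  have "\<tau> (x \<otimes> s [^] (0 + j)) \<preceq> \<tau> (x \<otimes> s [^] (0::nat)) \<otimes> s [^] j"
  proof (rule path_le[OF s])
    show "inv \<tau> (x \<otimes> s [^] i) \<otimes> \<tau> (x \<otimes> s [^] Suc i) \<in> S" for i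
      using cayley_iso_edge[OF iso, of "x \<otimes> s [^] i" "x \<otimes> s [^] Suc i"] x s sS
      by (simp add: inv_mult_group m_assoc)
  qed (use \<tau>c x s in auto)
  then have "x \<otimes> s [^] j \<otimes> ?g \<preceq> \<tau> x \<otimes> s [^] j" using j x by simp
  then have "inv x \<otimes> (x \<otimes> s [^] j \<otimes> ?g) \<preceq> inv x \<otimes> (\<tau> x \<otimes> s [^] j)"
    by (intro le_mult_left) (use x s \<tau>c in auto)
  then have "s [^] j \<otimes> ?g \<preceq> ?g \<otimes> s [^] j" using x s \<tau>c by (simp add: m_assoc)
  then show ?thesis using mult_le_of_pow_le[OF s(1) _ j(1)] x \<tau>c by simp
qed

text \<open>The displacements of \<open>\<tau>\<close> at \<open>x\<close> and of \<open>\<tau>\<^sup>-\<^sup>1\<close> at \<open>\<tau>(x)\<close> are mutually inverse, so the previous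
  inequality, applied to both, makes them commute with \<open>s\<close>.\<close>

lemma bounded_automorphism_max_edge:
  assumes iso: "cayley_iso G S G S \<tau>" and sS: "s \<in> S"
    and s: "s \<in> carrier G" "S \<subseteq> carrier G" "\<And>t. t \<in> S \<Longrightarrow> t \<preceq> s"
    and bdd: "finite ((\<lambda>x. inv x \<otimes> \<tau> x) ` carrier G)" and x: "x \<in> carrier G"
  shows "\<tau> (x \<otimes> s) = \<tau> x \<otimes> s"
proof -
  note \<tau>c = cayley_iso_closed[OF iso]
  define g where "g = inv x \<otimes> \<tau> x"
  have gc: "g \<in> carrier G" using x \<tau>c by (simp add: g_def)
  define \<sigma> where "\<sigma> = inv_into (carrier G) \<tau>"
  note \<sigma> = cayley_iso_inv_into[OF iso, folded \<sigma>_def]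
  note \<sigma>c = cayley_iso_closed[OF \<sigma>(1)]
  \<comment> \<open>The displacements of the inverse \<open>\<sigma>\<close> are inverses of
    displacements of \<open>\<tau>\<close>, so \<open>\<sigma>\<close> is bounded too.\<close>
  have "(\<lambda>y. inv y \<otimes> \<sigma> y) ` carrier G \<subseteq> (\<lambda>g. inv g) ` (\<lambda>x. inv x \<otimes> \<tau> x) ` carrier G"
  proof clarify
    fix y assume y: "y \<in> carrier G"
    have "inv y \<otimes> \<sigma> y = inv (inv (\<sigma> y) \<otimes> \<tau> (\<sigma> y))"
      using y \<sigma>(3) \<sigma>c by (simp add: inv_mult_group)
    then show "inv y \<otimes> \<sigma> y \<in> (\<lambda>g. inv g) ` (\<lambda>x. inv x \<otimes> \<tau> x) ` carrier G"
      using y \<sigma>c by blast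
  qed
  then have "finite ((\<lambda>y. inv y \<otimes> \<sigma> y) ` carrier G)" using bdd finite_subset by blast
  from bounded_displacement_le[OF \<sigma>(1) sS s this, of "\<tau> x"]
  have "s \<otimes> inv g \<preceq> inv g \<otimes> s"
    using x \<tau>c \<sigma>(2) by (simp add: g_def inv_mult_group)
  then have "g \<otimes> (s \<otimes> inv g) \<otimes> g \<preceq> g \<otimes> (inv g \<otimes> s) \<otimes> g"
    by (intro le_mult_left le_mult_right) (use gc s in auto)
  then have "g \<otimes> s \<preceq> s \<otimes> g" using gc s by (simp add: m_assoc)
  moreover have "s \<otimes> g \<preceq> g \<otimes> s"
    using bounded_displacement_le[OF iso sS s bdd x] by (simp add: g_def)
  ultimately have comm: "s \<otimes> g = g \<otimes> s" using gc s by (intro le_antisym) auto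
  have comm_pow: "s [^] n \<otimes> g = g \<otimes> s [^] n" for n :: nat
    using mult_pow_le[OF s(1) gc] mult_pow_ge[OF s(1) gc] gc s comm by (intro le_antisym) auto
  obtain j :: nat where j: "0 < j" "\<tau> (x \<otimes> s [^] j) = x \<otimes> s [^] j \<otimes> g"
    using displacement_recurs[OF iso sS s bdd x] by (auto simp: g_def)
  have endp: "\<tau> (x \<otimes> s [^] j) = \<tau> x \<otimes> s [^] j"
  proof -
    have "\<tau> (x \<otimes> s [^] j) = x \<otimes> g \<otimes> s [^] j" using j(2) x s gc comm_pow by (simp add: m_assoc)
    then show ?thesis using x \<tau>c by (simp add: g_def)
  qed
  \<comment> \<open>By \<open>endp\<close> the image path joins \<open>\<tau> x\<close> to
    \<open>\<tau> x \<otimes> s [^] j\<close> in \<open>j\<close> steps, so it is the line itself;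
    the claim is its value at index 1.\<close>
  have "\<tau> (x \<otimes> s [^] (1::nat)) = \<tau> (x \<otimes> s [^] (0::nat)) \<otimes> s [^] (1::nat)"
  proof (rule unique_geodesic[OF s, where y = "\<lambda>i. \<tau> (x \<otimes> s [^] i)" and n = j])
    show "inv \<tau> (x \<otimes> s [^] i) \<otimes> \<tau> (x \<otimes> s [^] Suc i) \<in> S" for i
      using cayley_iso_edge[OF iso, of "x \<otimes> s [^] i" "x \<otimes> s [^] Suc i"] x s sS
      by (simp add: inv_mult_group m_assoc)
    show "\<tau> (x \<otimes> s [^] i) \<in> carrier G" for i :: nat using \<tau>c x s by simp
    show "\<tau> (x \<otimes> s [^] j) = \<tau> (x \<otimes> s [^] (0::nat)) \<otimes> s [^] j" using endp x by simp
    show "1 \<le> j" using j by simp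
  qed
  then show ?thesis using x s by simp
qed

text \<open>The induction deletes a maximal label and its inverse from \<open>S\<close>. This may
  destroy generation, so the claim is about single edges; the global form is drawn in
  \<open>bounded_automorphism_central\<close>.\<close>

lemma bounded_automorphism_edge:
  assumes "finite S" "symmetric_subset G S" "cayley_iso G S G S \<tau>"
    and bdd: "finite ((\<lambda>x. inv x \<otimes> \<tau> x) ` carrier G)"
    and "x \<in> carrier G" "t \<in> S"
  shows "\<tau> (x \<otimes> t) = \<tau> x \<otimes> t"
  \<comment> \<open>The bound \<open>bdd\<close> concerns \<open>\<tau>\<close> alone and stays
    fixed while \<open>S\<close> shrinks.\<close>
  using assms(1-3,5,6)
proof (induction S arbitrary: x t rule: finite_psubset_induct)
  case (psubset S)
  note iso = psubset.prems(2)
  note \<tau>c = cayley_iso_closed[OF iso]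
  note SG = symmetric_subset_carrier[OF psubset.prems(1)]
  obtain s where s: "s \<in> S" "\<And>t. t \<in> S \<Longrightarrow> t \<preceq> s"
    using finite_has_max[OF psubset.hyps(1) _ SG] psubset.prems(4) by blast
  have sc: "s \<in> carrier G" using s SG by blast
  have edge: "\<tau> (x \<otimes> s) = \<tau> x \<otimes> s" if "x \<in> carrier G" for x
    using bounded_automorphism_max_edge[OF iso s(1) sc SG s(2) bdd that] by blast
  have edge': "\<tau> (x \<otimes> inv s) = \<tau> x \<otimes> inv s" if "x \<in> carrier G" for x
  proof -
    have "\<tau> x = \<tau> (x \<otimes> inv s) \<otimes> s" using edge[of "x \<otimes> inv s"] that sc by (simp add: m_assoc)
    then show ?thesis using that sc \<tau>c by (simp add: m_assoc)
  qed
  show ?case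
  proof (cases "t \<in> {s, inv s}")
    case True
    then show ?thesis using edge edge' psubset.prems by auto
  next
    case False
    let ?S = "S - {s, inv s}"
    have "inv t \<in> ?S" if t: "t \<in> ?S" for t
    proof -
      have "t \<in> carrier G" "inv t \<in> S" using t SG symmetric_subset_inv[OF psubset.prems(1)] by auto
      moreover have "inv t \<noteq> s" "inv t \<noteq> inv s" using t \<open>t \<in> carrier G\<close> sc by (metis DiffD2 inv_inv insertCI)+
      ultimately show ?thesis by simp
    qed
    then have sym: "symmetric_subset G ?S" using SG by (intro symmetric_subsetI) auto
    \<comment> \<open>Arcs labelled \<open>s\<close> or \<open>inv s\<close> are neither created nor
      lost, since \<open>\<tau>\<close> respects these labels and is injective. Deleting both labels
      therefore leaves \<open>\<tau>\<close> an automorphism.\<close>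
    have same: "inv x \<otimes> y = e \<longleftrightarrow> inv (\<tau> x) \<otimes> \<tau> y = e"
      if xy: "x \<in> carrier G" "y \<in> carrier G" and e: "e \<in> {s, inv s}" for x y e
    proof -
      have ec: "e \<in> carrier G" and te: "\<tau> (x \<otimes> e) = \<tau> x \<otimes> e" using e sc edge edge' xy by auto
      have "inv x \<otimes> y = e \<longleftrightarrow> y = x \<otimes> e" using xy ec by (simp add: inv_mult_eq_iff)
      also have "\<dots> \<longleftrightarrow> \<tau> y = \<tau> (x \<otimes> e)" using cayley_iso_inj[OF iso] xy ec by auto
      also have "\<dots> \<longleftrightarrow> inv (\<tau> x) \<otimes> \<tau> y = e" unfolding te using xy ec \<tau>c by (simp add: inv_mult_eq_iff)
      finally show ?thesis .
    qed
    have "cayley_iso G ?S G ?S \<tau>"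
      using iso same unfolding cayley_iso_def by auto
    then show ?thesis using psubset.IH[OF _ sym] s(1) psubset.prems False by blast
  qed
qed

end

definition group_center :: "('a, 'm) monoid_scheme \<Rightarrow> 'a set"
  where "group_center G = {z \<in> carrier G. \<forall>x \<in> carrier G. z \<otimes>\<^bsub>G\<^esub> x = x \<otimes>\<^bsub>G\<^esub> z}"

text \<open>Path induction with the edge rule turns \<open>\<tau>\<close> into left translation by
  \<open>a = \<tau> \<one>\<close>. Its displacement at \<open>x^n\<close> is the conjugate of
  \<open>a\<close> by \<open>x^n\<close>; two of these coincide by finiteness, so \<open>a\<close>
  commutes with a positive power of \<open>x\<close>, hence with \<open>x\<close> by
  \<open>pow_commute_imp_commute\<close>.\<close>

lemma (in bi_ordered_group) bounded_automorphism_central: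
  assumes "finite S" and S: "symmetric_subset G S" and gen: "generate G S = carrier G"
    and iso: "cayley_iso G S G S \<tau>"
    and bdd: "finite ((\<lambda>x. inv x \<otimes> \<tau> x) ` carrier G)"
  shows "\<tau> \<one> \<in> group_center G" and "\<And>x. x \<in> carrier G \<Longrightarrow> \<tau> x = \<tau> \<one> \<otimes> x"
proof -
  note \<tau>c = cayley_iso_closed[OF iso]
  define a where "a = \<tau> \<one>"
  have a: "a \<in> carrier G" using \<tau>c by (simp add: a_def)
  have \<tau>: "\<tau> x = a \<otimes> x" if "x \<in> carrier G" for x
    using S gen that
  proof (induction x rule: generate_path_induct)
    case (step x s)
    then show ?case
      using bounded_automorphism_edge[OF assms(1) S iso bdd] symmetric_subset_carrier[OF S] a
      by (auto simp: m_assoc)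
  qed (simp add: a_def \<tau>c)
  show "\<And>x. x \<in> carrier G \<Longrightarrow> \<tau> x = \<tau> \<one> \<otimes> x" using \<tau> unfolding a_def by blast
  have "a \<otimes> x = x \<otimes> a" if x: "x \<in> carrier G" for x
  proof -
    let ?F = "\<lambda>n::nat. inv (x [^] n) \<otimes> (a \<otimes> x [^] n)"
    have "range ?F \<subseteq> (\<lambda>x. inv x \<otimes> \<tau> x) ` carrier G"
      using x \<tau> by (auto intro!: image_eqI[where x = "x [^] _"])
    then have "finite (range ?F)" using bdd finite_subset by blast
    then have "\<not> inj ?F" using finite_imageD infinite_UNIV_nat by blast
    then obtain n m where nm: "n < m" "?F n = ?F m"
      unfolding inj_def by (metis linorder_neqE_nat)
    define k where "k = m - n"
    have m: "x [^] m = x [^] k \<otimes> x [^] n" using x nm by (simp add: nat_pow_mult k_def)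
    have "x [^] m \<otimes> ?F n \<otimes> inv (x [^] n) = x [^] m \<otimes> ?F m \<otimes> inv (x [^] n)" using nm by simp
    then have "x [^] k \<otimes> a = a \<otimes> x [^] k" using x a by (simp add: m m_assoc inv_mult_group)
    then show ?thesis using pow_commute_imp_commute[OF x a, of k] nm by (simp add: k_def)
  qed
  then have "a \<in> group_center G" using a by (simp add: group_center_def)
  then show "\<tau> \<one> \<in> group_center G" by (simp only: a_def)
qed


section \<open>Central elements\<close>

context group
begin

lemma center_carrier: "z \<in> group_center G \<Longrightarrow> z \<in> carrier G"
  by (simp add: group_center_def)

lemma center_commute: "z \<in> group_center G \<Longrightarrow> x \<in> carrier G \<Longrightarrow> z \<otimes> x = x \<otimes> z"
  by (simp add: group_center_def)

lemma one_center: "\<one> \<in> group_center G"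
  by (simp add: group_center_def)

lemma mult_center:
  assumes "z \<in> group_center G" "w \<in> group_center G" shows "z \<otimes> w \<in> group_center G"
proof -
  have "z \<otimes> w \<otimes> x = x \<otimes> (z \<otimes> w)" if x: "x \<in> carrier G" for x
  proof -
    have c: "z \<in> carrier G" "w \<in> carrier G" using assms by (simp_all add: center_carrier)
    have "z \<otimes> w \<otimes> x = z \<otimes> (x \<otimes> w)" using center_commute[OF assms(2) x] c x by (simp add: m_assoc)
    also have "\<dots> = z \<otimes> x \<otimes> w" using c x by (simp add: m_assoc)
    also have "z \<otimes> x = x \<otimes> z" by (rule center_commute[OF assms(1) x])
    finally show ?thesis using c x by (simp add: m_assoc)
  qed
  moreover have "z \<otimes> w \<in> carrier G" using assms by (simp add: center_carrier)
  ultimately show ?thesis unfolding group_center_def by blast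
qed

lemma inv_center:
  assumes z: "z \<in> group_center G" shows "inv z \<in> group_center G"
proof -
  have "inv z \<otimes> x = x \<otimes> inv z" if x: "x \<in> carrier G" for x
  proof -
    have "inv z \<otimes> (z \<otimes> x) \<otimes> inv z = inv z \<otimes> (x \<otimes> z) \<otimes> inv z" using center_commute[OF z x] by simp
    then show ?thesis using center_carrier[OF z] x by (simp add: m_assoc)
  qed
  then show ?thesis using center_carrier[OF z] by (simp add: group_center_def)
qed

lemma lower_central_carrier: "lower_central G n \<subseteq> carrier G"
proof (induction n)
  case (Suc n)
  then show ?case unfolding lower_central.simps by (intro generate_incl) auto
qed simp

text \<open>This is what keeps the central quotient torsion-free. By induction on \<open>d\<close>,
  \<open>x\<close> commutes with \<open>lower_central G (n - d)\<close>, which is the whole group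
  for \<open>d = n\<close>. In the step the commutator \<open>w\<close> of \<open>x\<close> and
  \<open>y\<close> commutes with \<open>x\<close>, so \<open>x^k y = w^k y x^k\<close>; as
  \<open>x^k\<close> is central, \<open>w^k = \<one>\<close> and thus
  \<open>w = \<one>\<close>.\<close>

lemma pow_center_imp_center:
  assumes tf: "torsion_free G" and nil: "lower_central G n = {\<one>}"
    and x: "x \<in> carrier G" and k: "0 < (k::nat)" "x [^] k \<in> group_center G"
  shows "x \<in> group_center G"
proof -
  have "y \<in> lower_central G (n - d) \<Longrightarrow> x \<otimes> y = y \<otimes> x" for d y
  proof (induction d arbitrary: y)
    case 0
    then show ?case using nil x by simp
  next
    case (Suc d)
    show ?case
    proof (cases "n \<le> d")
      \<comment> \<open>Truncated subtraction: \<open>n - d\<close> and \<open>n - Suc d\<close> are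
        both 0.\<close>
      case True
      then show ?thesis using Suc by simp
    next
      case False
      have y: "y \<in> carrier G" using Suc.prems lower_central_carrier by blast
      \<comment> \<open>\<open>lower_central\<close> is generated by commutators with the member of
        the previous term in first place; the inverse is taken to obtain
        \<open>x y = w y x\<close>.\<close>
      define w where "w = inv (y \<otimes> x \<otimes> inv y \<otimes> inv x)"
      have wc: "w \<in> carrier G" using x y by (simp add: w_def)
      have "n - d = Suc (n - Suc d)" using False by simp
      then have "w \<in> lower_central G (n - d)"
        unfolding w_def using Suc.prems x by (auto intro!: generate.inv)
      then have xw: "x \<otimes> w = w \<otimes> x" by (rule Suc.IH)
      have step: "x \<otimes> y = w \<otimes> y \<otimes> x" using x y by (simp add: w_def inv_mult_group m_assoc)
      have pow: "x [^] i \<otimes> y = w [^] i \<otimes> y \<otimes> x [^] i" for i :: nat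
      proof (induction i)
        case (Suc i)
        have xwi: "x \<otimes> w [^] i = w [^] i \<otimes> x"
          using group_commutes_pow[of w x i] xw wc x by simp
        have "x [^] Suc i \<otimes> y = x \<otimes> (x [^] i \<otimes> y)"
          using x y by (simp only: nat_pow_Suc2 m_assoc nat_pow_closed)
        also have "\<dots> = x \<otimes> w [^] i \<otimes> (y \<otimes> x [^] i)" using Suc x y wc by (simp add: m_assoc)
        also have "\<dots> = w [^] i \<otimes> (x \<otimes> y) \<otimes> x [^] i" using xwi x y wc by (simp add: m_assoc)
        also have "\<dots> = w [^] Suc i \<otimes> y \<otimes> (x \<otimes> x [^] i)" using step x y wc by (simp add: m_assoc)
        also have "x \<otimes> x [^] i = x [^] Suc i" using x by (simp only: nat_pow_Suc2)
        finally show ?case .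
      qed (use y in simp)
      have "w [^] k \<otimes> (y \<otimes> x [^] k) = y \<otimes> x [^] k"
        using pow[of k] center_commute[OF k(2) y] x y wc by (simp add: m_assoc)
      then have "w [^] k = \<one>" using x y wc by (simp add: r_cancel_one)
      then have "w = \<one>" using tf k(1) wc by (auto simp: torsion_free_def)
      then show ?thesis using step x y by simp
    qed
  qed
  from this[of _ n] show ?thesis using x by (simp add: group_center_def)
qed

end

section \<open>The effect of an isomorphism of Cayley graphs on generators and on central
  elements\<close>

lemma cayley_iso_generators:
  assumes G: "group G" and H: "group H"
    and S: "symmetric_subset G S" and gen: "generate G S = carrier G"
    and T: "symmetric_subset H T" and iso: "cayley_iso G S H T \<phi>" and one: "\<phi> \<one>\<^bsub>G\<^esub> = \<one>\<^bsub>H\<^esub>"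
  shows "T = \<phi> ` S" and "generate H T = carrier H"
proof -
  interpret G: group G by (rule G)
  interpret H: group H by (rule H)
  note \<phi>c = cayley_iso_closed[OF iso]
  note SG = G.symmetric_subset_carrier[OF S] and TH = H.symmetric_subset_carrier[OF T]
  show "T = \<phi> ` S"
  proof
    show "\<phi> ` S \<subseteq> T"
      using cayley_iso_edge[OF iso, of "\<one>\<^bsub>G\<^esub>"] SG \<phi>c one by auto
    show "T \<subseteq> \<phi> ` S"
    proof
      fix t assume t: "t \<in> T"
      then obtain s where s: "s \<in> carrier G" "t = \<phi> s"
        using cayley_iso_surj[OF iso] TH by blast
      then have "s \<in> S" using cayley_iso_edge[OF iso, of "\<one>\<^bsub>G\<^esub>" s] t one \<phi>c by simp
      then show "t \<in> \<phi> ` S" using s by blast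
    qed
  qed
  have edge: "inv\<^bsub>H\<^esub> (\<phi> x) \<otimes>\<^bsub>H\<^esub> \<phi> (x \<otimes>\<^bsub>G\<^esub> s) \<in> T" if "x \<in> carrier G" "s \<in> S" for x s
    using cayley_iso_edge[OF iso, of x "x \<otimes>\<^bsub>G\<^esub> s"] that SG by auto
  show "generate H T = carrier H"
  proof
    show "carrier H \<subseteq> generate H T"
    proof
      fix y assume "y \<in> carrier H"
      then obtain x where x: "x \<in> carrier G" "y = \<phi> x" using cayley_iso_surj[OF iso] by blast
      have "\<phi> x \<in> generate H T"
        using S gen x(1)
      proof (induction x rule: G.generate_path_induct)
        case base
        show ?case by (simp add: one generate.one)
      next
        case (step x s)
        have "\<phi> x \<otimes>\<^bsub>H\<^esub> (inv\<^bsub>H\<^esub> (\<phi> x) \<otimes>\<^bsub>H\<^esub> \<phi> (x \<otimes>\<^bsub>G\<^esub> s)) \<in> generate H T"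
          by (rule generate.eng[OF step(3) generate.incl[OF edge[OF step(1,2)]]])
        then show ?case using step SG \<phi>c by (auto simp: subset_iff)
      qed
      then show "y \<in> generate H T" using x by simp
    qed
  qed (use H.generate_incl[OF TH] in auto)
qed

text \<open>Left translation by \<open>z\<close>, conjugated by \<open>\<phi>\<close>, is an
  automorphism \<open>\<tau>\<close> of the Cayley graph of \<open>H\<close>. Once its displacement
  is known to be bounded, \<open>bounded_automorphism_central\<close> identifies it as translation
  by the central element \<open>\<phi> z\<close>.\<close>

lemma cayley_iso_central:
  assumes G: "group G" and H: "bi_ordered_group H P"
    and fin: "finite S" and S: "symmetric_subset G S" and gen: "generate G S = carrier G"
    and T: "symmetric_subset H T" and iso: "cayley_iso G S H T \<phi>" and one: "\<phi> \<one>\<^bsub>G\<^esub> = \<one>\<^bsub>H\<^esub>"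
    and z: "z \<in> group_center G"
  shows "\<phi> z \<in> group_center H"
    and "\<And>x. x \<in> carrier G \<Longrightarrow> \<phi> (z \<otimes>\<^bsub>G\<^esub> x) = \<phi> z \<otimes>\<^bsub>H\<^esub> \<phi> x"
proof -
  interpret G: group G by (rule G)
  interpret H: bi_ordered_group H P by (rule H)
  note \<phi>c = cayley_iso_closed[OF iso]
  note SG = G.symmetric_subset_carrier[OF S] and TH = H.symmetric_subset_carrier[OF T]
  note generators = cayley_iso_generators[OF G H.group_axioms S gen T iso one]
  have finT: "finite T" using generators(1) fin by simp
  note genT = generators(2)
  have edge: "inv\<^bsub>H\<^esub> (\<phi> x) \<otimes>\<^bsub>H\<^esub> \<phi> (x \<otimes>\<^bsub>G\<^esub> s) \<in> T" if "x \<in> carrier G" "s \<in> S" for x s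
    using cayley_iso_edge[OF iso, of x "x \<otimes>\<^bsub>G\<^esub> s"] that SG by auto
  define \<psi> where "\<psi> = inv_into (carrier G) \<phi>"
  note \<psi> = cayley_iso_inv_into[OF iso, folded \<psi>_def]
  note \<psi>c = cayley_iso_closed[OF \<psi>(1)]
  have zc: "z \<in> carrier G" by (rule G.center_carrier[OF z])
  define \<tau> where "\<tau> = (\<lambda>y. \<phi> (z \<otimes>\<^bsub>G\<^esub> \<psi> y))"
  have \<tau>_iso: "cayley_iso H T H T \<tau>"
    unfolding \<tau>_def
    by (rule cayley_iso_comp[OF cayley_iso_comp[OF \<psi>(1) G.cayley_iso_left_mult[OF zc]] iso])
  \<comment> \<open>Right multiplication by a fixed \<open>h\<close> moves images under
    \<open>\<phi>\<close> by products of a fixed number of elements of the finite set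
    \<open>T\<close>.\<close>
  have bounded: "finite ((\<lambda>x. inv\<^bsub>H\<^esub> (\<phi> x) \<otimes>\<^bsub>H\<^esub> \<phi> (x \<otimes>\<^bsub>G\<^esub> h)) ` carrier G)" (is "finite (?D h)")
    if "h \<in> generate G S" for h
    using that
  proof induction
    case one
    have "?D \<one>\<^bsub>G\<^esub> \<subseteq> {\<one>\<^bsub>H\<^esub>}" using \<phi>c by auto
    then show ?case by (rule finite_subset) simp
  next
    case (incl h)
    then have "?D h \<subseteq> T" using edge by auto
    then show ?case using finT by (rule finite_subset)
  next
    case (inv h)
    then have "?D (inv\<^bsub>G\<^esub> h) \<subseteq> T" using edge G.symmetric_subset_inv[OF S] by auto
    then show ?case using finT by (rule finite_subset)
  next
    case (eng h1 h2)
    have hc: "h1 \<in> carrier G" "h2 \<in> carrier G" using eng.hyps G.generate_incl[OF SG] by auto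
    have "?D (h1 \<otimes>\<^bsub>G\<^esub> h2) \<subseteq> (\<lambda>(a, b). a \<otimes>\<^bsub>H\<^esub> b) ` (?D h1 \<times> ?D h2)"
    proof clarify
      fix x assume x: "x \<in> carrier G"
      let ?y = "x \<otimes>\<^bsub>G\<^esub> h1"
      have "inv\<^bsub>H\<^esub> (\<phi> x) \<otimes>\<^bsub>H\<^esub> \<phi> (x \<otimes>\<^bsub>G\<^esub> (h1 \<otimes>\<^bsub>G\<^esub> h2)) =
          (inv\<^bsub>H\<^esub> (\<phi> x) \<otimes>\<^bsub>H\<^esub> \<phi> ?y) \<otimes>\<^bsub>H\<^esub> (inv\<^bsub>H\<^esub> (\<phi> ?y) \<otimes>\<^bsub>H\<^esub> \<phi> (?y \<otimes>\<^bsub>G\<^esub> h2))"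
        using x hc \<phi>c by (simp add: H.m_assoc G.m_assoc)
      then show "inv\<^bsub>H\<^esub> (\<phi> x) \<otimes>\<^bsub>H\<^esub> \<phi> (x \<otimes>\<^bsub>G\<^esub> (h1 \<otimes>\<^bsub>G\<^esub> h2)) \<in> (\<lambda>(a, b). a \<otimes>\<^bsub>H\<^esub> b) ` (?D h1 \<times> ?D h2)"
        using x hc by (auto intro!: image_eqI[where x = "(_, _)"])
    qed
    moreover have "finite ((\<lambda>(a, b). a \<otimes>\<^bsub>H\<^esub> b) ` (?D h1 \<times> ?D h2))"
      by (intro finite_imageI finite_cartesian_product eng.IH)
    ultimately show ?case by (rule finite_subset)
  qed
  \<comment> \<open>Centrality of \<open>z\<close> enters here: it turns the left translation in
    \<open>\<tau>\<close> into the right multiplication covered by \<open>bounded\<close>.\<close>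
  have "(\<lambda>y. inv\<^bsub>H\<^esub> y \<otimes>\<^bsub>H\<^esub> \<tau> y) ` carrier H \<subseteq> ?D z"
  proof clarify
    fix y assume y: "y \<in> carrier H"
    then show "inv\<^bsub>H\<^esub> y \<otimes>\<^bsub>H\<^esub> \<tau> y \<in> ?D z"
      using \<psi>c[OF y] \<psi>(3)[OF y] G.center_commute[OF z]
      by (intro image_eqI[where x = "\<psi> y"]) (auto simp: \<tau>_def)
  qed
  then have bdd: "finite ((\<lambda>y. inv\<^bsub>H\<^esub> y \<otimes>\<^bsub>H\<^esub> \<tau> y) ` carrier H)"
    using bounded[of z] zc gen finite_subset by blast
  have \<tau>\<phi>: "\<tau> (\<phi> x) = \<phi> (z \<otimes>\<^bsub>G\<^esub> x)" if "x \<in> carrier G" for x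
    using \<psi>(2)[OF that] by (simp add: \<tau>_def)
  have \<tau>1: "\<tau> \<one>\<^bsub>H\<^esub> = \<phi> z" using \<tau>\<phi>[of "\<one>\<^bsub>G\<^esub>"] one zc by simp
  note central = H.bounded_automorphism_central[OF finT T genT \<tau>_iso bdd]
  show "\<phi> z \<in> group_center H" using central(1) \<tau>1 by simp
  show "\<phi> (z \<otimes>\<^bsub>G\<^esub> x) = \<phi> z \<otimes>\<^bsub>H\<^esub> \<phi> x" if "x \<in> carrier G" for x
    using central(2)[OF \<phi>c[OF that]] \<tau>\<phi>[OF that] \<tau>1 by simp
qed


section \<open>Central quotients and bi-orders of nilpotent groups\<close>

text \<open>By \<open>surj\<close> and \<open>eq_iff\<close>, the fibres of \<open>\<pi>\<close> are
  the cosets of the center, so \<open>Q\<close> is the quotient of \<open>G\<close> by its center up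
  to isomorphism, whatever its elements are.\<close>

locale central_quotient = group_hom G Q \<pi> for G (structure) and Q and \<pi> +
  assumes surj: "\<pi> ` carrier G = carrier Q"
    and eq_iff: "x \<in> carrier G \<Longrightarrow> y \<in> carrier G \<Longrightarrow> \<pi> x = \<pi> y \<longleftrightarrow> inv x \<otimes> y \<in> group_center G"

text \<open>The quotient is carried by coset representatives instead of cosets: as it has the type of
  the group itself, one can do induction on the nilpotency class in simply typed logic.\<close>

lemma (in group) central_quotient_exists:
  obtains Q :: "('a, 'b) monoid_scheme" and \<pi> where "central_quotient G Q \<pi>"
proof -
  let ?Z = "group_center G"
  define \<pi> where "\<pi> x = (SOME y. y \<in> carrier G \<and> inv x \<otimes> y \<in> ?Z)" for x
  have \<pi>: "\<pi> x \<in> carrier G" "inv x \<otimes> \<pi> x \<in> ?Z" if "x \<in> carrier G" for x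
  proof -
    have "x \<in> carrier G \<and> inv x \<otimes> x \<in> ?Z" using that one_center by simp
    then have "\<pi> x \<in> carrier G \<and> inv x \<otimes> \<pi> x \<in> ?Z" unfolding \<pi>_def by (rule someI)
    then show "\<pi> x \<in> carrier G" "inv x \<otimes> \<pi> x \<in> ?Z" by auto
  qed
  have trans: "inv x \<otimes> w \<in> ?Z" if "x \<in> carrier G" "y \<in> carrier G" "w \<in> carrier G"
    "inv x \<otimes> y \<in> ?Z" "inv y \<otimes> w \<in> ?Z" for x y w
    using mult_center[OF that(4,5)] that by (simp add: m_assoc)
  have sym: "inv y \<otimes> x \<in> ?Z" if "x \<in> carrier G" "y \<in> carrier G" "inv x \<otimes> y \<in> ?Z" for x y
    using inv_center[OF that(3)] that by (simp add: inv_mult_group)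
  have eq: "\<pi> x = \<pi> y \<longleftrightarrow> inv x \<otimes> y \<in> ?Z" if xy: "x \<in> carrier G" "y \<in> carrier G" for x y
  proof
    assume "\<pi> x = \<pi> y"
    then show "inv x \<otimes> y \<in> ?Z" using trans[of x "\<pi> x" y] sym[of y "\<pi> y"] \<pi> xy by metis
  next
    assume a: "inv x \<otimes> y \<in> ?Z"
    have "inv x \<otimes> w \<in> ?Z \<longleftrightarrow> inv y \<otimes> w \<in> ?Z" if "w \<in> carrier G" for w
      using trans[of x y w] trans[of y x w] sym[of x y] a xy that by blast
    \<comment> \<open>Congruent elements define the same predicate, hence \<open>SOME\<close>
      chooses the same representative for both.\<close>
    then have "(\<lambda>w. w \<in> carrier G \<and> inv x \<otimes> w \<in> ?Z) = (\<lambda>w. w \<in> carrier G \<and> inv y \<otimes> w \<in> ?Z)"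
      by blast
    then show "\<pi> x = \<pi> y" by (simp add: \<pi>_def)
  qed
  \<comment> \<open>A record update of \<open>G\<close> keeps its further fields and thereby its
    type.\<close>
  define Q where "Q = G\<lparr>carrier := \<pi> ` carrier G, mult := \<lambda>x y. \<pi> (x \<otimes> y), one := \<pi> \<one>\<rparr>"
  have mult: "\<pi> (\<pi> x \<otimes> \<pi> y) = \<pi> (x \<otimes> y)" if xy: "x \<in> carrier G" "y \<in> carrier G" for x y
  proof -
    define z w where "z = inv x \<otimes> \<pi> x" and "w = inv y \<otimes> \<pi> y"
    have zw: "z \<in> ?Z" "w \<in> ?Z" using \<pi> xy by (simp_all add: z_def w_def)
    have zwc: "z \<in> carrier G" "w \<in> carrier G" using zw by (simp_all add: center_carrier)
    have "\<pi> x = x \<otimes> z" "\<pi> y = y \<otimes> w" using \<pi> xy by (simp_all add: z_def w_def)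
    then have "inv (x \<otimes> y) \<otimes> (\<pi> x \<otimes> \<pi> y) = inv y \<otimes> (z \<otimes> y) \<otimes> w"
      using xy zwc by (simp add: inv_mult_group m_assoc)
    also have "\<dots> = z \<otimes> w" using center_commute[OF zw(1) xy(2)] xy zwc by (simp add: m_assoc)
    finally show ?thesis using eq[of "x \<otimes> y" "\<pi> x \<otimes> \<pi> y"] mult_center[OF zw] \<pi> xy by simp
  qed
  have idem: "\<pi> (\<pi> x) = \<pi> x" if "x \<in> carrier G" for x using eq[of x "\<pi> x"] \<pi> that by simp
  have mult1: "\<pi> (\<pi> x \<otimes> y) = \<pi> (x \<otimes> y)" "\<pi> (x \<otimes> \<pi> y) = \<pi> (x \<otimes> y)"
    if "x \<in> carrier G" "y \<in> carrier G" for x y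
    using mult[of "\<pi> x" y] mult[of x "\<pi> y"] mult[of x y] idem \<pi> that by simp_all
  have Q: "group Q"
  proof (rule groupI)
    show "\<exists>y \<in> carrier Q. y \<otimes>\<^bsub>Q\<^esub> x = \<one>\<^bsub>Q\<^esub>" if "x \<in> carrier Q" for x
    proof -
      from that obtain u where u: "u \<in> carrier G" "x = \<pi> u" by (auto simp: Q_def)
      then have "\<pi> (inv u) \<in> carrier Q" "\<pi> (inv u) \<otimes>\<^bsub>Q\<^esub> x = \<one>\<^bsub>Q\<^esub>"
        by (simp_all add: Q_def mult)
      then show ?thesis by blast
    qed
  qed (auto simp: Q_def mult mult1 m_assoc \<pi>)
  interpret Q: group Q by (rule Q)
  have "central_quotient G Q \<pi>"
  proof unfold_locales
    show "\<pi> \<in> hom G Q" by (auto simp: hom_def Q_def mult)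
    show "\<pi> ` carrier G = carrier Q" by (simp add: Q_def)
  qed (use eq in auto)
  then show thesis by (rule that)
qed

context central_quotient
begin

lemma eq_one_iff: "x \<in> carrier G \<Longrightarrow> \<pi> x = \<one>\<^bsub>Q\<^esub> \<longleftrightarrow> x \<in> group_center G"
  using eq_iff[of \<one> x] by auto

lemma lower_central_quotient: "lower_central Q n = \<pi> ` lower_central G n"
proof (induction n)
  case 0
  show ?case by (simp add: surj)
next
  case (Suc n)
  let ?C = "\<Union>x \<in> lower_central G n. \<Union>y \<in> carrier G. {x \<otimes> y \<otimes> inv x \<otimes> inv y}"
  have sub: "lower_central G n \<subseteq> carrier G" by (rule G.lower_central_carrier)
  have comm: "\<pi> (x \<otimes> y \<otimes> inv x \<otimes> inv y)
      = \<pi> x \<otimes>\<^bsub>Q\<^esub> \<pi> y \<otimes>\<^bsub>Q\<^esub> inv\<^bsub>Q\<^esub> \<pi> x \<otimes>\<^bsub>Q\<^esub> inv\<^bsub>Q\<^esub> \<pi> y"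
    if "x \<in> carrier G" "y \<in> carrier G" for x y
    using that by simp
  have "(\<Union>x \<in> lower_central Q n. \<Union>y \<in> carrier Q. {x \<otimes>\<^bsub>Q\<^esub> y \<otimes>\<^bsub>Q\<^esub> inv\<^bsub>Q\<^esub> x \<otimes>\<^bsub>Q\<^esub> inv\<^bsub>Q\<^esub> y})
      = (\<Union>x \<in> lower_central G n. \<Union>y \<in> carrier G. {\<pi> (x \<otimes> y \<otimes> inv x \<otimes> inv y)})"
    unfolding Suc surj[symmetric] using sub comm by (auto simp: subset_iff)
  also have "\<dots> = \<pi> ` ?C" by auto
  finally have eq: "(\<Union>x \<in> lower_central Q n. \<Union>y \<in> carrier Q.
      {x \<otimes>\<^bsub>Q\<^esub> y \<otimes>\<^bsub>Q\<^esub> inv\<^bsub>Q\<^esub> x \<otimes>\<^bsub>Q\<^esub> inv\<^bsub>Q\<^esub> y}) = \<pi> ` ?C" .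
  have "?C \<subseteq> carrier G" using sub by auto
  then show ?case unfolding lower_central.simps eq by (rule generate_img)
qed

text \<open>The commutators of \<open>lower_central G n\<close> with the whole group lie in the next
  term, which is trivial. So this term is central and dies in \<open>Q\<close>.\<close>

lemma lower_central_quotient_trivial:
  assumes "lower_central G (Suc n) = {\<one>}"
  shows "lower_central Q n = {\<one>\<^bsub>Q\<^esub>}"
proof -
  have "x \<in> group_center G" if x: "x \<in> lower_central G n" for x
  proof -
    have xc: "x \<in> carrier G" using x G.lower_central_carrier by blast
    have "x \<otimes> y = y \<otimes> x" if y: "y \<in> carrier G" for y
    proof -
      have "x \<otimes> y \<otimes> inv x \<otimes> inv y \<in> lower_central G (Suc n)"
        using x y by (auto intro!: generate.incl)
      then have "x \<otimes> y \<otimes> inv x \<otimes> inv y \<otimes> y \<otimes> x = y \<otimes> x" using assms xc y by simp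
      then show ?thesis using xc y by (simp add: G.m_assoc)
    qed
    then show ?thesis using xc by (simp add: group_center_def)
  qed
  then have "\<pi> ` lower_central G n \<subseteq> {\<one>\<^bsub>Q\<^esub>}"
    using eq_one_iff G.lower_central_carrier by blast
  moreover have "\<one> \<in> lower_central G n" by (cases n) (auto intro: generate.one)
  then have "\<one>\<^bsub>Q\<^esub> \<in> \<pi> ` lower_central G n" by (metis hom_one imageI)
  ultimately show ?thesis unfolding lower_central_quotient by auto
qed

lemma torsion_free_quotient:
  assumes tf: "torsion_free G" and nil: "lower_central G n = {\<one>}"
  shows "torsion_free Q"
  unfolding torsion_free_def
proof (intro ballI allI impI)
  fix x and k :: nat assume x: "x \<in> carrier Q" "0 < k" "x [^]\<^bsub>Q\<^esub> k = \<one>\<^bsub>Q\<^esub>"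
  then obtain u where u: "u \<in> carrier G" "x = \<pi> u" using surj by auto
  have "\<pi> (u [^] k) = \<one>\<^bsub>Q\<^esub>" using u x by (simp add: hom_nat_pow)
  then have "u [^] k \<in> group_center G" using eq_one_iff u by simp
  then have "u \<in> group_center G" by (rule G.pow_center_imp_center[OF tf nil u(1) x(2)])
  then show "x = \<one>\<^bsub>Q\<^esub>" using eq_one_iff u by simp
qed

text \<open>Adjacency in the quotient graph is expressed by arcs of the original graph up to a
  central factor. The factor stands on the left of \<open>y\<close> to match the multiplicativity in
  \<open>cayley_iso_central\<close>.\<close>

lemma edge_quotient_iff:
  assumes S: "S \<subseteq> carrier G" and xy: "x \<in> carrier G" "y \<in> carrier G"
  shows "inv\<^bsub>Q\<^esub> (\<pi> x) \<otimes>\<^bsub>Q\<^esub> \<pi> y \<in> \<pi> ` S \<longleftrightarrow>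
    (\<exists>z \<in> group_center G. inv x \<otimes> (z \<otimes> y) \<in> S)"
proof
  assume "inv\<^bsub>Q\<^esub> (\<pi> x) \<otimes>\<^bsub>Q\<^esub> \<pi> y \<in> \<pi> ` S"
  then obtain s where s: "s \<in> S" "\<pi> (inv x \<otimes> y) = \<pi> s" using xy by auto
  have sc: "s \<in> carrier G" using s S by blast
  define z where "z = inv (inv x \<otimes> y) \<otimes> s"
  have z: "z \<in> group_center G" using eq_iff[of "inv x \<otimes> y" s] s sc xy by (simp add: z_def)
  have "inv x \<otimes> (y \<otimes> z) = s" using xy sc by (simp add: z_def G.inv_mult_group G.m_assoc)
  then have "inv x \<otimes> (z \<otimes> y) \<in> S" using G.center_commute[OF z xy(2)] s by simp
  then show "\<exists>z \<in> group_center G. inv x \<otimes> (z \<otimes> y) \<in> S" using z by blast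
next
  assume "\<exists>z \<in> group_center G. inv x \<otimes> (z \<otimes> y) \<in> S"
  then obtain z where z: "z \<in> group_center G" "inv x \<otimes> (z \<otimes> y) \<in> S" by blast
  have zc: "z \<in> carrier G" by (rule G.center_carrier[OF z(1)])
  have "\<pi> (inv x \<otimes> (z \<otimes> y)) = inv\<^bsub>Q\<^esub> (\<pi> x) \<otimes>\<^bsub>Q\<^esub> \<pi> y"
    using xy zc eq_one_iff[OF zc] z by simp
  then show "inv\<^bsub>Q\<^esub> (\<pi> x) \<otimes>\<^bsub>Q\<^esub> \<pi> y \<in> \<pi> ` S" using z(2) by (metis imageI)
qed

lemma symmetric_subset_quotient:
  assumes S: "symmetric_subset G S" shows "symmetric_subset Q (\<pi> ` S)"
proof (rule H.symmetric_subsetI)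
  note SG = G.symmetric_subset_carrier[OF S]
  show "\<pi> ` S \<subseteq> carrier Q" using SG surj by blast
  show "inv\<^bsub>Q\<^esub> t \<in> \<pi> ` S" if "t \<in> \<pi> ` S" for t
  proof -
    from that obtain s where s: "s \<in> S" "t = \<pi> s" by blast
    then have "inv\<^bsub>Q\<^esub> t = \<pi> (inv s)" using SG by auto
    then show ?thesis using G.symmetric_subset_inv[OF S s(1)] by blast
  qed
qed

end

text \<open>This is orderability of torsion-free abelian groups, applied to the center. Zorn's lemma
  gives a maximal multiplicatively closed subset \<open>M\<close> of the center that avoids
  \<open>\<one>\<close>. By maximality, a nontrivial central \<open>u\<close> outside
  \<open>M\<close> has some \<open>inv (u^k)\<close> in \<open>M\<close> with \<open>k > 0\<close>.
  If \<open>x\<close> and \<open>inv x\<close> were both outside, \<open>M\<close> would contain a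
  power of \<open>x\<close> together with its inverse.\<close>

lemma (in group) center_cone_exists:
  assumes tf: "torsion_free G"
  obtains P where "P \<subseteq> group_center G" "\<one> \<notin> P" "\<And>x y. x \<in> P \<Longrightarrow> y \<in> P \<Longrightarrow> x \<otimes> y \<in> P"
    "\<And>x. x \<in> group_center G \<Longrightarrow> x \<noteq> \<one> \<Longrightarrow> x \<in> P \<or> inv x \<in> P"
proof -
  let ?Z = "group_center G"
  define A where "A = {P. P \<subseteq> ?Z \<and> \<one> \<notin> P \<and> (\<forall>x \<in> P. \<forall>y \<in> P. x \<otimes> y \<in> P)}"
  have "\<exists>M \<in> A. \<forall>X \<in> A. M \<subseteq> X \<longrightarrow> X = M"
  proof (rule subset_Zorn')
    fix C assume "subset.chain A C"
    then have C: "C \<subseteq> A" "\<And>X Y. X \<in> C \<Longrightarrow> Y \<in> C \<Longrightarrow> X \<subseteq> Y \<or> Y \<subseteq> X"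
      by (auto simp: subset_chain_def)
    have "x \<otimes> y \<in> \<Union>C" if xy: "x \<in> \<Union>C" "y \<in> \<Union>C" for x y
    proof -
      obtain X Y where XY: "X \<in> C" "x \<in> X" "Y \<in> C" "y \<in> Y" using xy by blast
      then obtain W where "W \<in> C" "x \<in> W" "y \<in> W" using C(2)[OF XY(1,3)] by blast
      then show ?thesis using C(1) by (auto simp: A_def)
    qed
    then show "\<Union>C \<in> A" using C(1) by (auto simp: A_def)
  qed
  then obtain M where MA: "M \<in> A" and max: "\<And>X. X \<in> A \<Longrightarrow> M \<subseteq> X \<Longrightarrow> X = M" by blast
  have M: "M \<subseteq> ?Z" "\<one> \<notin> M" "\<And>x y. x \<in> M \<Longrightarrow> y \<in> M \<Longrightarrow> x \<otimes> y \<in> M"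
    using MA by (auto simp: A_def)
  have MG: "x \<in> carrier G" if "x \<in> M" for x using that M(1) center_carrier by blast
  have powM: "x [^] k \<in> M" if "x \<in> M" "0 < k" for x and k :: nat
    using that(2)
  proof (induction k rule: nat_induct_non_zero)
    case 1
    then show ?case using that MG by simp
  next
    case (Suc k)
    then show ?case using M(3) that by simp
  qed
  have pow: "\<exists>k>0. inv (u [^] (k::nat)) \<in> M" if u: "u \<in> ?Z" "u \<noteq> \<one>" "u \<notin> M" for u
  proof -
    have uc: "u \<in> carrier G" by (rule center_carrier[OF u(1)])
    have upow: "u [^] k \<in> ?Z" for k :: nat
      by (induction k) (use u one_center mult_center in auto)
    \<comment> \<open>\<open>X\<close> is the closure of \<open>M\<close> and \<open>u\<close> under
      multiplication; by maximality of \<open>M\<close> it must contain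
      \<open>\<one>\<close>.\<close>
    define X where "X = M \<union> {p \<otimes> u [^] k | p k. p \<in> insert \<one> M \<and> 0 < (k::nat)}"
    have "u \<in> {p \<otimes> u [^] k | p k. p \<in> insert \<one> M \<and> 0 < (k::nat)}"
      using uc by (auto intro!: exI[of _ \<one>] exI[of _ "1::nat"])
    then have "X \<noteq> M" using u(3) by (auto simp: X_def)
    moreover have "M \<subseteq> X" by (auto simp: X_def)
    ultimately have "X \<notin> A" using max by blast
    moreover have "X \<subseteq> ?Z" using M(1) upow mult_center one_center by (auto simp: X_def)
    moreover have "x \<otimes> y \<in> X" if xy: "x \<in> X" "y \<in> X" for x y
    proof -
      \<comment> \<open>A uniform shape for both parts of \<open>X\<close>: all formal products
        \<open>p u^k\<close> except the one with \<open>p = \<one>\<close> and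
        \<open>k = 0\<close>.\<close>
      have X_iff: "v \<in> X \<longleftrightarrow> (\<exists>p \<in> insert \<one> M. \<exists>k::nat. v = p \<otimes> u [^] k \<and> (p \<in> M \<or> 0 < k))" for v
      proof
        assume v: "v \<in> X"
        show "\<exists>p \<in> insert \<one> M. \<exists>k::nat. v = p \<otimes> u [^] k \<and> (p \<in> M \<or> 0 < k)"
        proof (cases "v \<in> M")
          case True
          then have "v = v \<otimes> u [^] (0::nat)" using MG by simp
          then show ?thesis using True by blast
        next
          case False
          then show ?thesis using v unfolding X_def by blast
        qed
      next
        assume "\<exists>p \<in> insert \<one> M. \<exists>k::nat. v = p \<otimes> u [^] k \<and> (p \<in> M \<or> 0 < k)"
        then obtain p k where pk: "p \<in> insert \<one> M" "v = p \<otimes> u [^] (k::nat)" "p \<in> M \<or> 0 < k" by blast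
        show "v \<in> X"
        proof (cases "k = 0")
          case True
          then show ?thesis using pk MG by (auto simp: X_def)
        next
          case False
          then show ?thesis using pk unfolding X_def by blast
        qed
      qed
      obtain p k where p: "p \<in> insert \<one> M" "x = p \<otimes> u [^] (k::nat)" "p \<in> M \<or> 0 < k"
        using xy X_iff by blast
      obtain q l where q: "q \<in> insert \<one> M" "y = q \<otimes> u [^] (l::nat)" "q \<in> M \<or> 0 < l"
        using xy X_iff by blast
      have c: "p \<in> carrier G" "q \<in> carrier G" using p q MG by auto
      have "x \<otimes> y = p \<otimes> (u [^] k \<otimes> q) \<otimes> u [^] l" using p q c uc by (simp add: m_assoc)
      also have "\<dots> = p \<otimes> q \<otimes> u [^] (k + l)"
        using center_commute[OF upow c(2)] c uc by (simp add: m_assoc nat_pow_mult)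
      finally have "x \<otimes> y = p \<otimes> q \<otimes> u [^] (k + l)" .
      moreover have "p \<otimes> q \<in> insert \<one> M" "p \<otimes> q \<in> M \<or> 0 < k + l"
        using p q M(3) MG by auto
      ultimately show ?thesis using X_iff by blast
    qed
    ultimately have "\<one> \<in> X" by (auto simp: A_def)
    then obtain p k where pk: "p \<in> insert \<one> M" "0 < (k::nat)" "p \<otimes> u [^] k = \<one>"
      using M(2) by (force simp: X_def)
    \<comment> \<open>Otherwise \<open>u\<close> would be a nontrivial torsion element.\<close>
    have "p \<noteq> \<one>" using tf pk uc u(2) by (auto simp: torsion_free_def)
    then have "p \<in> M" using pk by simp
    moreover have "p = inv (u [^] k)" using pk uc MG[OF \<open>p \<in> M\<close>] by (metis inv_equality nat_pow_closed inv_inv inv_closed)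
    ultimately show ?thesis using pk by blast
  qed
  have "x \<in> M \<or> inv x \<in> M" if x: "x \<in> ?Z" "x \<noteq> \<one>" for x
  proof (rule ccontr)
    assume no: "\<not> (x \<in> M \<or> inv x \<in> M)"
    have xc: "x \<in> carrier G" by (rule center_carrier[OF x(1)])
    obtain k :: nat where k: "0 < k" "inv (x [^] k) \<in> M" using pow[of x] x no by blast
    have "inv x \<noteq> \<one>" using x xc by (metis inv_inv inv_one)
    then obtain l :: nat where l: "0 < l" "inv (inv x [^] l) \<in> M"
      using pow[of "inv x"] inv_center[OF x(1)] no by blast
    have "inv (inv x [^] l) = x [^] l" using xc by (simp add: nat_pow_inv)
    then have "x [^] (l * k) \<in> M" using powM[OF l(2) k(1)] xc by (simp add: nat_pow_pow)
    moreover have "inv (x [^] (l * k)) \<in> M"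
      using powM[OF k(2) l(1)] xc by (simp add: nat_pow_inv nat_pow_pow mult.commute)
    ultimately show False using M(2,3) xc by (metis r_inv nat_pow_closed)
  qed
  then show thesis using that M by blast
qed

text \<open>The order is lexicographic: the image in \<open>Q\<close> decides first, and a cone
  \<open>C\<close> of the center decides when that image is trivial. Conjugation fixes
  \<open>C\<close> pointwise, so the combined cone is invariant.\<close>

lemma (in central_quotient) bi_ordered_lift:
  assumes tf: "torsion_free G" and Q: "bi_ordered_group Q R"
  shows "\<exists>P. bi_ordered_group G P"
proof -
  interpret Q: bi_ordered_group Q R by (rule Q)
  obtain C where C: "C \<subseteq> group_center G" "\<one> \<notin> C" "\<And>x y. x \<in> C \<Longrightarrow> y \<in> C \<Longrightarrow> x \<otimes> y \<in> C"
    "\<And>x. x \<in> group_center G \<Longrightarrow> x \<noteq> \<one> \<Longrightarrow> x \<in> C \<or> inv x \<in> C"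
    using G.center_cone_exists[OF tf] by blast
  have Cc: "x \<in> carrier G" "\<pi> x = \<one>\<^bsub>Q\<^esub>" if "x \<in> C" for x
    using that C(1) G.center_carrier eq_one_iff by auto
  define P where "P = {x \<in> carrier G. \<pi> x \<in> R} \<union> C"
  have R: "x \<in> carrier Q" if "x \<in> R" for x using that Q.pos_carrier by blast
  have "bi_ordered_group G P"
  proof unfold_locales
    show "P \<subseteq> carrier G" using Cc by (auto simp: P_def)
    show "\<one> \<notin> P" using C(2) Q.one_not_pos by (simp add: P_def)
    show "x \<otimes> y \<in> P" if "x \<in> P" "y \<in> P" for x y
      using that C(3) Cc Q.pos_mult R by (auto simp: P_def)
    show "inv y \<otimes> x \<otimes> y \<in> P" if x: "x \<in> P" and y: "y \<in> carrier G" for x y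
    proof (cases "x \<in> C")
      case True
      then have "x \<otimes> y = y \<otimes> x" using C(1) G.center_commute y by blast
      then have "inv y \<otimes> x \<otimes> y = x" using y Cc[OF True] by (simp add: G.m_assoc)
      then show ?thesis using x by simp
    next
      case False
      then show ?thesis using x y Q.pos_conj by (simp add: P_def)
    qed
    show "x \<in> P \<or> inv x \<in> P" if x: "x \<in> carrier G" "x \<noteq> \<one>" for x
    proof (cases "\<pi> x = \<one>\<^bsub>Q\<^esub>")
      case True
      then show ?thesis using C(4) x eq_one_iff by (auto simp: P_def)
    next
      case False
      then show ?thesis using Q.pos_total[of "\<pi> x"] x by (auto simp: P_def)
    qed
  qed
  then show ?thesis ..
qed

lemma torsion_free_nilpotent_bi_orderable:
  fixes G :: "('a, 'm) monoid_scheme"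
  assumes "group G" "torsion_free G" "lower_central G n = {\<one>\<^bsub>G\<^esub>}"
  shows "\<exists>P. bi_ordered_group G P"
  using assms
proof (induction n arbitrary: G)
  case 0
  then interpret group G by simp
  have "bi_ordered_group G {}" by unfold_locales (use 0 in auto)
  then show ?case ..
next
  case (Suc n)
  then interpret group G by simp
  obtain Q :: "('a, 'm) monoid_scheme" and \<pi> where "central_quotient G Q \<pi>"
    by (rule central_quotient_exists)
  then interpret central_quotient G Q \<pi> .
  have "\<exists>R. bi_ordered_group Q R"
    using Suc.IH[OF H.group_axioms] torsion_free_quotient lower_central_quotient_trivial Suc.prems
    by blast
  then show ?case using bi_ordered_lift Suc.prems by blast
qed


section \<open>Rigidity of isomorphisms of Cayley graphs\<close>

text \<open>For fixed \<open>g\<close> write \<open>\<phi>(g x) = \<phi>(g) \<phi>(x) f(x)\<close> with central \<open>f(x)\<close>.  The edges from \<open>\<phi>(x)\<close> into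
  a fixed coset of the center form a finite set that is invariant under translation by
  \<open>f(x)\<^sup>-\<^sup>1 f(x s)\<close>, which must therefore be trivial.\<close>

lemma cayley_iso_hom_lift:
  assumes G: "group G" and H: "group H" and tf: "torsion_free H"
    and fin: "finite T" and S: "symmetric_subset G S" and gen: "generate G S = carrier G"
    and iso: "cayley_iso G S H T \<phi>" and one: "\<phi> \<one>\<^bsub>G\<^esub> = \<one>\<^bsub>H\<^esub>"
    and central: "\<phi> ` group_center G = group_center H"
    and mult: "\<And>z x. z \<in> group_center G \<Longrightarrow> x \<in> carrier G \<Longrightarrow> \<phi> (z \<otimes>\<^bsub>G\<^esub> x) = \<phi> z \<otimes>\<^bsub>H\<^esub> \<phi> x"
    and hom: "\<And>x y. x \<in> carrier G \<Longrightarrow> y \<in> carrier G \<Longrightarrow>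
      inv\<^bsub>H\<^esub> (\<phi> x \<otimes>\<^bsub>H\<^esub> \<phi> y) \<otimes>\<^bsub>H\<^esub> \<phi> (x \<otimes>\<^bsub>G\<^esub> y) \<in> group_center H"
  shows "\<phi> \<in> hom G H"
proof -
  interpret G: group G by (rule G)
  interpret H: group H by (rule H)
  note \<phi>c = cayley_iso_closed[OF iso]
  note SG = G.symmetric_subset_carrier[OF S]
  have "\<phi> (g \<otimes>\<^bsub>G\<^esub> x) = \<phi> g \<otimes>\<^bsub>H\<^esub> \<phi> x" if g: "g \<in> carrier G" and x: "x \<in> carrier G" for g x
  proof -
    define f where "f x = inv\<^bsub>H\<^esub> (\<phi> g \<otimes>\<^bsub>H\<^esub> \<phi> x) \<otimes>\<^bsub>H\<^esub> \<phi> (g \<otimes>\<^bsub>G\<^esub> x)" for x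
    have fZ: "f x \<in> group_center H" if "x \<in> carrier G" for x using hom[OF g that] by (simp add: f_def)
    have fc: "f x \<in> carrier H" if "x \<in> carrier G" for x using fZ[OF that] by (rule H.center_carrier)
    have f: "\<phi> (g \<otimes>\<^bsub>G\<^esub> x) = \<phi> g \<otimes>\<^bsub>H\<^esub> \<phi> x \<otimes>\<^bsub>H\<^esub> f x" if "x \<in> carrier G" for x
      using g that \<phi>c by (simp add: f_def)
    \<comment> \<open>The correction \<open>f\<close> is constant on cosets of the center, so all
      neighbours of \<open>x\<close> in one coset are shifted by the same central element.\<close>
    have f_center: "f (z \<otimes>\<^bsub>G\<^esub> x) = f x" if z: "z \<in> group_center G" and x: "x \<in> carrier G" for z x
    proof -
      have zc: "z \<in> carrier G" by (rule G.center_carrier[OF z])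
      have \<phi>z: "\<phi> z \<in> group_center H" using central z by blast
      have c: "\<phi> g \<in> carrier H" "\<phi> z \<in> carrier H" "\<phi> x \<in> carrier H" "f x \<in> carrier H"
          "f (z \<otimes>\<^bsub>G\<^esub> x) \<in> carrier H"
        using g zc x \<phi>c fc by auto
      have "g \<otimes>\<^bsub>G\<^esub> (z \<otimes>\<^bsub>G\<^esub> x) = z \<otimes>\<^bsub>G\<^esub> (g \<otimes>\<^bsub>G\<^esub> x)"
        using G.center_commute[OF z g] g x zc by (simp flip: G.m_assoc)
      then have "\<phi> g \<otimes>\<^bsub>H\<^esub> \<phi> (z \<otimes>\<^bsub>G\<^esub> x) \<otimes>\<^bsub>H\<^esub> f (z \<otimes>\<^bsub>G\<^esub> x) = \<phi> z \<otimes>\<^bsub>H\<^esub> \<phi> (g \<otimes>\<^bsub>G\<^esub> x)"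
        using f[of "z \<otimes>\<^bsub>G\<^esub> x"] mult[OF z, of "g \<otimes>\<^bsub>G\<^esub> x"] g x zc by simp
      also have "\<dots> = \<phi> z \<otimes>\<^bsub>H\<^esub> \<phi> g \<otimes>\<^bsub>H\<^esub> \<phi> x \<otimes>\<^bsub>H\<^esub> f x"
        using f[OF x] c by (simp add: H.m_assoc)
      also have "\<phi> z \<otimes>\<^bsub>H\<^esub> \<phi> g = \<phi> g \<otimes>\<^bsub>H\<^esub> \<phi> z" by (rule H.center_commute[OF \<phi>z c(1)])
      also have "\<dots> \<otimes>\<^bsub>H\<^esub> \<phi> x \<otimes>\<^bsub>H\<^esub> f x = \<phi> g \<otimes>\<^bsub>H\<^esub> \<phi> (z \<otimes>\<^bsub>G\<^esub> x) \<otimes>\<^bsub>H\<^esub> f x"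
        using mult[OF z x] c by (simp add: H.m_assoc)
      finally show ?thesis using c zc x \<phi>c by simp
    qed
    have f_step: "f (x \<otimes>\<^bsub>G\<^esub> s) = f x" if x: "x \<in> carrier G" and s: "s \<in> S" for x s
    proof -
      have sc: "s \<in> carrier G" using s SG by blast
      define w where "w = inv\<^bsub>H\<^esub> (f x) \<otimes>\<^bsub>H\<^esub> f (x \<otimes>\<^bsub>G\<^esub> s)"
      have wZ: "w \<in> group_center H"
        unfolding w_def using fZ x sc by (intro H.mult_center H.inv_center) auto
      have wc: "w \<in> carrier H" by (rule H.center_carrier[OF wZ])
      \<comment> \<open>\<open>F\<close> consists of the labels of the image arcs from
        \<open>\<phi> x\<close> to the neighbours of \<open>x\<close> in the central coset of
        \<open>x s\<close>.\<close>
      define F where "F = {inv\<^bsub>H\<^esub> (\<phi> x) \<otimes>\<^bsub>H\<^esub> \<phi> (x \<otimes>\<^bsub>G\<^esub> (z \<otimes>\<^bsub>G\<^esub> s)) | z.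
        z \<in> group_center G \<and> z \<otimes>\<^bsub>G\<^esub> s \<in> S}"
      have FT: "F \<subseteq> T"
      proof
        fix t assume "t \<in> F"
        then obtain z where z: "z \<in> group_center G" "z \<otimes>\<^bsub>G\<^esub> s \<in> S"
          "t = inv\<^bsub>H\<^esub> (\<phi> x) \<otimes>\<^bsub>H\<^esub> \<phi> (x \<otimes>\<^bsub>G\<^esub> (z \<otimes>\<^bsub>G\<^esub> s))" by (auto simp: F_def)
        then show "t \<in> T"
          using cayley_iso_edge[OF iso x, of "x \<otimes>\<^bsub>G\<^esub> (z \<otimes>\<^bsub>G\<^esub> s)"] x sc
          by (simp add: G.center_carrier)
      qed
      have Fw: "t \<otimes>\<^bsub>H\<^esub> w \<in> F" if "t \<in> F" for t
      proof -
        from that obtain z where z: "z \<in> group_center G" "z \<otimes>\<^bsub>G\<^esub> s \<in> S"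
          and t: "t = inv\<^bsub>H\<^esub> (\<phi> x) \<otimes>\<^bsub>H\<^esub> \<phi> (x \<otimes>\<^bsub>G\<^esub> (z \<otimes>\<^bsub>G\<^esub> s))" by (auto simp: F_def)
        have zc: "z \<in> carrier G" by (rule G.center_carrier[OF z(1)])
        let ?y = "x \<otimes>\<^bsub>G\<^esub> (z \<otimes>\<^bsub>G\<^esub> s)"
        have yc: "?y \<in> carrier G" using x zc sc by simp
        have slide: "x \<otimes>\<^bsub>G\<^esub> (v \<otimes>\<^bsub>G\<^esub> u) = v \<otimes>\<^bsub>G\<^esub> (x \<otimes>\<^bsub>G\<^esub> u)"
          if "v \<in> group_center G" "u \<in> carrier G" for v u
          using G.center_commute[OF that(1) x] G.center_carrier[OF that(1)] that(2) x
          by (simp flip: G.m_assoc)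
        have fy: "f ?y = f (x \<otimes>\<^bsub>G\<^esub> s)"
          using slide[OF z(1) sc] f_center[OF z(1)] x sc by simp
        have c: "\<phi> g \<in> carrier H" "\<phi> x \<in> carrier H" "\<phi> ?y \<in> carrier H"
            "f x \<in> carrier H" "f (x \<otimes>\<^bsub>G\<^esub> s) \<in> carrier H"
          using g x yc sc \<phi>c fc by auto
        have tc: "t \<in> carrier H" using t c by simp
        have "inv\<^bsub>G\<^esub> (g \<otimes>\<^bsub>G\<^esub> x) \<otimes>\<^bsub>G\<^esub> (g \<otimes>\<^bsub>G\<^esub> ?y) \<in> S"
          using z g x zc sc by (simp add: G.inv_mult_group G.m_assoc)
        then have "inv\<^bsub>H\<^esub> (\<phi> (g \<otimes>\<^bsub>G\<^esub> x)) \<otimes>\<^bsub>H\<^esub> \<phi> (g \<otimes>\<^bsub>G\<^esub> ?y) \<in> T"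
          using cayley_iso_edge[OF iso, of "g \<otimes>\<^bsub>G\<^esub> x" "g \<otimes>\<^bsub>G\<^esub> ?y"] g x yc by simp
        also have "inv\<^bsub>H\<^esub> (\<phi> (g \<otimes>\<^bsub>G\<^esub> x)) \<otimes>\<^bsub>H\<^esub> \<phi> (g \<otimes>\<^bsub>G\<^esub> ?y) =
            inv\<^bsub>H\<^esub> (f x) \<otimes>\<^bsub>H\<^esub> t \<otimes>\<^bsub>H\<^esub> f (x \<otimes>\<^bsub>G\<^esub> s)"
          unfolding f[OF x] f[OF yc] fy t using c by (simp add: H.inv_mult_group H.m_assoc)
        also have "inv\<^bsub>H\<^esub> (f x) \<otimes>\<^bsub>H\<^esub> t = t \<otimes>\<^bsub>H\<^esub> inv\<^bsub>H\<^esub> (f x)"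
          by (rule H.center_commute[OF H.inv_center[OF fZ[OF x]] tc])
        finally have twT: "t \<otimes>\<^bsub>H\<^esub> w \<in> T" using tc c by (simp add: w_def H.m_assoc)
        \<comment> \<open>So far \<open>t w\<close> is only known to be a label in \<open>T\<close>.
          Writing \<open>w = \<phi> v\<close> shows that it leads to the image of a point in the
          same central coset, hence that it lies in \<open>F\<close>.\<close>
        have "w \<in> \<phi> ` group_center G" using wZ central by simp
        then obtain v where v: "v \<in> group_center G" "\<phi> v = w" by (metis imageE)
        have vc: "v \<in> carrier G" by (rule G.center_carrier[OF v(1)])
        have vz: "v \<otimes>\<^bsub>G\<^esub> z \<in> group_center G" by (rule G.mult_center[OF v(1) z(1)])
        let ?y' = "x \<otimes>\<^bsub>G\<^esub> (v \<otimes>\<^bsub>G\<^esub> z \<otimes>\<^bsub>G\<^esub> s)"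
        have y'c: "?y' \<in> carrier G" using x vc zc sc by simp
        have "\<phi> ?y' = w \<otimes>\<^bsub>H\<^esub> \<phi> ?y"
          using slide[OF v(1), of "z \<otimes>\<^bsub>G\<^esub> s"] mult[OF v(1) yc] v vc zc sc by (simp add: G.m_assoc)
        also have "\<dots> = \<phi> x \<otimes>\<^bsub>H\<^esub> (t \<otimes>\<^bsub>H\<^esub> w)"
          using H.center_commute[OF wZ c(3)] t c wc by (simp add: H.m_assoc)
        finally have tw: "t \<otimes>\<^bsub>H\<^esub> w = inv\<^bsub>H\<^esub> (\<phi> x) \<otimes>\<^bsub>H\<^esub> \<phi> ?y'"
          using c tc wc by simp
        then have "inv\<^bsub>G\<^esub> x \<otimes>\<^bsub>G\<^esub> ?y' \<in> S"
          using cayley_iso_edge[OF iso x y'c] twT by simp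
        then have "v \<otimes>\<^bsub>G\<^esub> z \<otimes>\<^bsub>G\<^esub> s \<in> S" using x vc zc sc by simp
        then show ?thesis using tw vz by (auto simp: F_def)
      qed
      define t where "t = inv\<^bsub>H\<^esub> (\<phi> x) \<otimes>\<^bsub>H\<^esub> \<phi> (x \<otimes>\<^bsub>G\<^esub> s)"
      have tc: "t \<in> carrier H" using \<phi>c x sc by (simp add: t_def)
      have "\<one>\<^bsub>G\<^esub> \<otimes>\<^bsub>G\<^esub> s \<in> S" "t = inv\<^bsub>H\<^esub> (\<phi> x) \<otimes>\<^bsub>H\<^esub> \<phi> (x \<otimes>\<^bsub>G\<^esub> (\<one>\<^bsub>G\<^esub> \<otimes>\<^bsub>G\<^esub> s))"
        using s sc by (simp_all add: t_def)
      then have "t \<in> F" using G.one_center unfolding F_def by blast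
      then have "t \<otimes>\<^bsub>H\<^esub> w [^]\<^bsub>H\<^esub> n \<in> F" for n :: nat
      proof (induction n)
        case (Suc n)
        then show ?case using Fw[OF Suc.IH] tc wc by (simp add: H.m_assoc)
      qed (use tc in simp)
      \<comment> \<open>All \<open>t w^n\<close> lie in the finite set \<open>T\<close>, so two
        powers of \<open>w\<close> coincide and torsion-freeness gives
        \<open>w = \<one>\<close>.\<close>
      then have "range (\<lambda>n::nat. t \<otimes>\<^bsub>H\<^esub> w [^]\<^bsub>H\<^esub> n) \<subseteq> T" using FT by blast
      then have "finite (range (\<lambda>n::nat. t \<otimes>\<^bsub>H\<^esub> w [^]\<^bsub>H\<^esub> n))" using fin finite_subset by blast
      then have "\<not> inj (\<lambda>n::nat. t \<otimes>\<^bsub>H\<^esub> w [^]\<^bsub>H\<^esub> n)" using finite_imageD infinite_UNIV_nat by blast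
      then obtain n m :: nat where nm: "n < m" "t \<otimes>\<^bsub>H\<^esub> w [^]\<^bsub>H\<^esub> n = t \<otimes>\<^bsub>H\<^esub> w [^]\<^bsub>H\<^esub> m"
        unfolding inj_def by (metis linorder_neqE_nat)
      have "w [^]\<^bsub>H\<^esub> m = w [^]\<^bsub>H\<^esub> n \<otimes>\<^bsub>H\<^esub> w [^]\<^bsub>H\<^esub> (m - n)" using wc nm by (simp add: H.nat_pow_mult)
      moreover have "w [^]\<^bsub>H\<^esub> m = w [^]\<^bsub>H\<^esub> n" using nm tc wc by simp
      ultimately have "w [^]\<^bsub>H\<^esub> (m - n) = \<one>\<^bsub>H\<^esub>" using wc by simp
      then have "w = \<one>\<^bsub>H\<^esub>" using tf wc nm(1) unfolding torsion_free_def by (metis zero_less_diff)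
      then show ?thesis
        using fc[OF x] fc[of "x \<otimes>\<^bsub>G\<^esub> s"] x sc by (simp add: w_def H.inv_mult_eq_iff)
    qed
    have "f x = \<one>\<^bsub>H\<^esub>"
      using S gen x
    proof (induction x rule: G.generate_path_induct)
      case base
      then show ?case using g one \<phi>c by (simp add: f_def)
    qed (simp add: f_step)
    then show ?thesis using f[OF x] g x \<phi>c by simp
  qed
  then show ?thesis using \<phi>c by (auto simp: hom_def)
qed

text \<open>The induction follows the length of the lower central series of \<open>G\<close>, with
  groups, connection sets and isomorphism generalised. The induced map \<open>\<theta>\<close> on
  the central quotients is a homomorphism by induction, so \<open>\<phi>\<close> is one up to
  central factors, and \<open>cayley_iso_hom_lift\<close> removes these.\<close>

lemma cayley_iso_hom:
  fixes G :: "('a, 'm) monoid_scheme" and H :: "('b, 'n) monoid_scheme"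
  assumes "group G" "torsion_free G" "lower_central G n = {\<one>\<^bsub>G\<^esub>}"
    and "group H" "torsion_free H" "nilpotent H"
    and "finite S" "symmetric_subset G S" "generate G S = carrier G" "symmetric_subset H T"
    and "cayley_iso G S H T \<phi>" "\<phi> \<one>\<^bsub>G\<^esub> = \<one>\<^bsub>H\<^esub>"
  shows "\<phi> \<in> hom G H"
  using assms
proof (induction n arbitrary: G H S T \<phi>)
  case 0
  interpret G: group G by fact
  interpret H: group H by fact
  have "carrier G = {\<one>\<^bsub>G\<^esub>}" using 0 by simp
  then show ?case using 0 by (auto simp: hom_def)
next
  case (Suc n)
  note tfG = Suc.prems(2) and nilG = Suc.prems(3) and tfH = Suc.prems(5) and nilH = Suc.prems(6)
    and fin = Suc.prems(7) and S = Suc.prems(8) and gen = Suc.prems(9) and T = Suc.prems(10)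
    and iso = Suc.prems(11) and one = Suc.prems(12)
  interpret G: group G by fact
  interpret H: group H by fact
  obtain m where m: "lower_central H m = {\<one>\<^bsub>H\<^esub>}" using nilH by (auto simp: nilpotent_def)
  \<comment> \<open>Both groups are ordered because \<open>cayley_iso_central\<close>, which asks
    for an order on the target, is applied to \<open>\<phi>\<close> and to its inverse.\<close>
  obtain P R where P: "bi_ordered_group G P" and R: "bi_ordered_group H R"
    using torsion_free_nilpotent_bi_orderable[OF G.group_axioms tfG nilG]
      torsion_free_nilpotent_bi_orderable[OF H.group_axioms tfH m] by blast
  note \<phi>c = cayley_iso_closed[OF iso]
  note SG = G.symmetric_subset_carrier[OF S] and TH = H.symmetric_subset_carrier[OF T]
  define \<psi> where "\<psi> = inv_into (carrier G) \<phi>"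
  note \<psi> = cayley_iso_inv_into[OF iso, folded \<psi>_def]
  have \<psi>1: "\<psi> \<one>\<^bsub>H\<^esub> = \<one>\<^bsub>G\<^esub>" using \<psi>(2)[of "\<one>\<^bsub>G\<^esub>"] one by simp
  note generators = cayley_iso_generators[OF G.group_axioms H.group_axioms S gen T iso one]
  have finT: "finite T" using generators(1) fin by simp
  note \<phi>Z = cayley_iso_central[OF G.group_axioms R fin S gen T iso one]
  note \<psi>Z = cayley_iso_central[OF H.group_axioms P finT T generators(2) S \<psi>(1) \<psi>1]
  have central: "\<phi> ` group_center G = group_center H"
  proof
    show "\<phi> ` group_center G \<subseteq> group_center H" using \<phi>Z(1) by blast
    show "group_center H \<subseteq> \<phi> ` group_center G"
    proof
      fix w assume w: "w \<in> group_center H"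
      then show "w \<in> \<phi> ` group_center G"
        using \<psi>Z(1)[OF w] \<psi>(3)[OF H.center_carrier[OF w]] by (metis imageI)
    qed
  qed
  obtain Q1 :: "('a, 'm) monoid_scheme" and \<pi>1 where "central_quotient G Q1 \<pi>1"
    by (rule G.central_quotient_exists)
  then interpret Q1: central_quotient G Q1 \<pi>1 .
  obtain Q2 :: "('b, 'n) monoid_scheme" and \<pi>2 where "central_quotient H Q2 \<pi>2"
    by (rule H.central_quotient_exists)
  then interpret Q2: central_quotient H Q2 \<pi>2 .
  \<comment> \<open>\<open>\<phi>\<close> carries cosets of the center to cosets of the center, in
    both directions: one makes \<open>\<theta>\<close> independent of the chosen preimage, the other
    makes it injective.\<close>
  have quot_iff: "\<pi>1 x = \<pi>1 y \<longleftrightarrow> \<pi>2 (\<phi> x) = \<pi>2 (\<phi> y)" if xy: "x \<in> carrier G" "y \<in> carrier G" for x y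
  proof
    assume "\<pi>1 x = \<pi>1 y"
    then have z: "inv\<^bsub>G\<^esub> x \<otimes>\<^bsub>G\<^esub> y \<in> group_center G" (is "?z \<in> _") using Q1.eq_iff xy by simp
    have "y = ?z \<otimes>\<^bsub>G\<^esub> x" using G.center_commute[OF z xy(1)] xy by simp
    then have "\<phi> y = \<phi> ?z \<otimes>\<^bsub>H\<^esub> \<phi> x" using \<phi>Z(2)[OF z xy(1)] by metis
    also have "\<dots> = \<phi> x \<otimes>\<^bsub>H\<^esub> \<phi> ?z" using H.center_commute[OF \<phi>Z(1)[OF z] \<phi>c[OF xy(1)]] .
    finally have "inv\<^bsub>H\<^esub> (\<phi> x) \<otimes>\<^bsub>H\<^esub> \<phi> y = \<phi> ?z" using xy \<phi>c by simp
    then show "\<pi>2 (\<phi> x) = \<pi>2 (\<phi> y)" using Q2.eq_iff \<phi>c xy \<phi>Z(1)[OF z] by simp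
  next
    assume "\<pi>2 (\<phi> x) = \<pi>2 (\<phi> y)"
    then have "inv\<^bsub>H\<^esub> (\<phi> x) \<otimes>\<^bsub>H\<^esub> \<phi> y \<in> group_center H" (is "?w \<in> _") using Q2.eq_iff xy \<phi>c by simp
    then obtain z where z: "z \<in> group_center G" "?w = \<phi> z" using central by blast
    have zc: "z \<in> carrier G" by (rule G.center_carrier[OF z(1)])
    have "\<phi> y = \<phi> x \<otimes>\<^bsub>H\<^esub> \<phi> z" using z(2) xy \<phi>c by (metis H.inv_mult_cancel_left(2))
    also have "\<dots> = \<phi> (z \<otimes>\<^bsub>G\<^esub> x)"
      using H.center_commute[OF \<phi>Z(1)[OF z(1)] \<phi>c[OF xy(1)]] \<phi>Z(2)[OF z(1) xy(1)] by simp
    finally have "y = z \<otimes>\<^bsub>G\<^esub> x" using cayley_iso_inj[OF iso] xy zc by simp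
    then have "inv\<^bsub>G\<^esub> x \<otimes>\<^bsub>G\<^esub> y = z" using G.center_commute[OF z(1) xy(1)] xy zc by simp
    then show "\<pi>1 x = \<pi>1 y" using Q1.eq_iff xy z by simp
  qed
  define \<theta> where "\<theta> a = \<pi>2 (\<phi> (inv_into (carrier G) \<pi>1 a))" for a
  have \<theta>: "\<theta> (\<pi>1 x) = \<pi>2 (\<phi> x)" if x: "x \<in> carrier G" for x
  proof -
    have "inv_into (carrier G) \<pi>1 (\<pi>1 x) \<in> carrier G" "\<pi>1 (inv_into (carrier G) \<pi>1 (\<pi>1 x)) = \<pi>1 x"
      using x by (auto intro: inv_into_into f_inv_into_f)
    then show ?thesis using quot_iff x by (simp add: \<theta>_def)
  qed
  have "\<theta> \<in> hom Q1 Q2"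
  proof (rule Suc.IH)
    show "group Q1" "group Q2" by unfold_locales
    show "torsion_free Q1" "torsion_free Q2"
      using Q1.torsion_free_quotient[OF tfG nilG] Q2.torsion_free_quotient[OF tfH m] by auto
    show "lower_central Q1 n = {\<one>\<^bsub>Q1\<^esub>}" by (rule Q1.lower_central_quotient_trivial[OF nilG])
    \<comment> \<open>For \<open>H\<close> only the existence of some length is carried along, so
      the same \<open>m\<close> serves for \<open>Q2\<close>.\<close>
    have "lower_central Q2 m = {\<one>\<^bsub>Q2\<^esub>}" unfolding Q2.lower_central_quotient m by simp
    then show "nilpotent Q2" by (auto simp: nilpotent_def)
    show "finite (\<pi>1 ` S)" using fin by simp
    show "symmetric_subset Q1 (\<pi>1 ` S)" "symmetric_subset Q2 (\<pi>2 ` T)"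
      using Q1.symmetric_subset_quotient[OF S] Q2.symmetric_subset_quotient[OF T] .
    show "generate Q1 (\<pi>1 ` S) = carrier Q1" using Q1.generate_img[OF SG] gen Q1.surj by simp
    show "\<theta> \<one>\<^bsub>Q1\<^esub> = \<one>\<^bsub>Q2\<^esub>" using \<theta>[of "\<one>\<^bsub>G\<^esub>"] one by simp
    show "cayley_iso Q1 (\<pi>1 ` S) Q2 (\<pi>2 ` T) \<theta>"
      unfolding cayley_iso_def
    proof (intro conjI ballI)
      show "bij_betw \<theta> (carrier Q1) (carrier Q2)"
        unfolding bij_betw_def
      proof
        show "inj_on \<theta> (carrier Q1)"
          unfolding Q1.surj[symmetric] by (rule inj_onI) (auto simp: \<theta> quot_iff)
        have "\<phi> ` carrier G = carrier H" using iso by (simp add: cayley_iso_def bij_betw_def)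
        then have "\<pi>2 ` \<phi> ` carrier G = carrier Q2" using Q2.surj by simp
        then show "\<theta> ` carrier Q1 = carrier Q2"
          unfolding Q1.surj[symmetric] by (simp add: image_image \<theta>)
      qed
      fix a b assume "a \<in> carrier Q1" "b \<in> carrier Q1"
      then obtain x y where x: "x \<in> carrier G" "a = \<pi>1 x" and y: "y \<in> carrier G" "b = \<pi>1 y"
        using Q1.surj by blast
      have "inv\<^bsub>Q1\<^esub> a \<otimes>\<^bsub>Q1\<^esub> b \<in> \<pi>1 ` S \<longleftrightarrow>
          (\<exists>z \<in> group_center G. inv\<^bsub>G\<^esub> x \<otimes>\<^bsub>G\<^esub> (z \<otimes>\<^bsub>G\<^esub> y) \<in> S)"
        unfolding x(2) y(2) by (rule Q1.edge_quotient_iff[OF SG x(1) y(1)])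
      also have "\<dots> \<longleftrightarrow> (\<exists>z \<in> group_center G. inv\<^bsub>H\<^esub> (\<phi> x) \<otimes>\<^bsub>H\<^esub> (\<phi> z \<otimes>\<^bsub>H\<^esub> \<phi> y) \<in> T)"
      proof (rule bex_cong[OF refl])
        fix z assume z: "z \<in> group_center G"
        show "inv\<^bsub>G\<^esub> x \<otimes>\<^bsub>G\<^esub> (z \<otimes>\<^bsub>G\<^esub> y) \<in> S \<longleftrightarrow> inv\<^bsub>H\<^esub> (\<phi> x) \<otimes>\<^bsub>H\<^esub> (\<phi> z \<otimes>\<^bsub>H\<^esub> \<phi> y) \<in> T"
          using cayley_iso_edge[OF iso x(1), of "z \<otimes>\<^bsub>G\<^esub> y"] \<phi>Z(2)[OF z y(1)]
            G.center_carrier[OF z] y(1) by simp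
      qed
      also have "\<dots> \<longleftrightarrow> (\<exists>w \<in> group_center H. inv\<^bsub>H\<^esub> (\<phi> x) \<otimes>\<^bsub>H\<^esub> (w \<otimes>\<^bsub>H\<^esub> \<phi> y) \<in> T)"
        unfolding central[symmetric] by blast
      also have "\<dots> \<longleftrightarrow> inv\<^bsub>Q2\<^esub> (\<theta> a) \<otimes>\<^bsub>Q2\<^esub> \<theta> b \<in> \<pi>2 ` T"
        unfolding x(2) y(2) \<theta>[OF x(1)] \<theta>[OF y(1)]
        by (rule Q2.edge_quotient_iff[OF TH \<phi>c[OF x(1)] \<phi>c[OF y(1)], symmetric])
      finally show "inv\<^bsub>Q1\<^esub> a \<otimes>\<^bsub>Q1\<^esub> b \<in> \<pi>1 ` S \<longleftrightarrow> inv\<^bsub>Q2\<^esub> (\<theta> a) \<otimes>\<^bsub>Q2\<^esub> \<theta> b \<in> \<pi>2 ` T" .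
    qed
  qed
  then have hom_\<theta>: "\<theta> (\<pi>1 x \<otimes>\<^bsub>Q1\<^esub> \<pi>1 y) = \<theta> (\<pi>1 x) \<otimes>\<^bsub>Q2\<^esub> \<theta> (\<pi>1 y)"
    if "x \<in> carrier G" "y \<in> carrier G" for x y
    using that by (simp add: hom_def)
  show ?case
  proof (rule cayley_iso_hom_lift[OF G.group_axioms H.group_axioms tfH finT S gen iso one central \<phi>Z(2)])
    fix x y assume xy: "x \<in> carrier G" "y \<in> carrier G"
    have "\<pi>2 (\<phi> (x \<otimes>\<^bsub>G\<^esub> y)) = \<pi>2 (\<phi> x \<otimes>\<^bsub>H\<^esub> \<phi> y)"
      using hom_\<theta>[OF xy] \<theta>[of "x \<otimes>\<^bsub>G\<^esub> y"] \<theta> xy \<phi>c by simp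
    then show "inv\<^bsub>H\<^esub> (\<phi> x \<otimes>\<^bsub>H\<^esub> \<phi> y) \<otimes>\<^bsub>H\<^esub> \<phi> (x \<otimes>\<^bsub>G\<^esub> y) \<in> group_center H"
      using Q2.eq_iff[of "\<phi> x \<otimes>\<^bsub>H\<^esub> \<phi> y" "\<phi> (x \<otimes>\<^bsub>G\<^esub> y)"] xy \<phi>c by simp
  qed
qed

section \<open>From isomorphisms of digraphs to isomorphisms of groups\<close>

lemma (in group) arcs_ends_cayley_graph_iff:
  assumes "symmetric_subset G S" "u \<in> carrier G" "v \<in> carrier G"
  shows "(u, v) \<in> arcs_ends (cayley_graph G S) \<longleftrightarrow> inv u \<otimes> v \<in> S"
proof
  assume "(u, v) \<in> arcs_ends (cayley_graph G S)"
  then obtain s where "s \<in> S" "v = u \<otimes> s" by (auto simp: arcs_ends_cayley_graph)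
  then show "inv u \<otimes> v \<in> S" using assms symmetric_subset_carrier[OF assms(1)] by auto
next
  assume s: "inv u \<otimes> v \<in> S"
  have "v = u \<otimes> (inv u \<otimes> v)" using assms by simp
  then show "(u, v) \<in> arcs_ends (cayley_graph G S)"
    unfolding arcs_ends_cayley_graph using s assms(2) by blast
qed

theorem theorem1p1:
  fixes G1 :: "('a, 'm) monoid_scheme" and G2 :: "('b, 'n) monoid_scheme"
    and S1 :: "'a set" and S2 :: "'b set"
  assumes "group G1" and "nilpotent G1" and "torsion_free G1"
    and "group G2" and "nilpotent G2" and "torsion_free G2"
    and "symmetric_subset G1 S1"
    and "Digraph_Component.connected (cayley_graph G1 S1)"
    and "finite_valency (cayley_graph G1 S1)"
    and "symmetric_subset G2 S2"
    and "digraph_iso (cayley_graph G1 S1) (cayley_graph G2 S2)"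
  shows "G1 \<cong> G2"
proof -
  interpret G1: group G1 by fact
  interpret G2: group G2 by fact
  note S1 = assms(7) and S2 = assms(10)
  have fin: "finite S1" using G1.finite_valency_cayley_graph[OF S1] assms(9) by simp
  have gen: "generate G1 S1 = carrier G1" using G1.connected_cayley_graph[OF S1] assms(8) by simp
  obtain f where bij: "bij_betw f (carrier G1) (carrier G2)"
    and adj: "\<forall>u \<in> carrier G1. \<forall>v \<in> carrier G1. (u, v) \<in> arcs_ends (cayley_graph G1 S1) \<longleftrightarrow>
      (f u, f v) \<in> arcs_ends (cayley_graph G2 S2)"
    using digraph_iso_cayley_graph[OF assms(1) S1 assms(4) S2] assms(11) by blast
  have f: "cayley_iso G1 S1 G2 S2 f"
    unfolding cayley_iso_def
  proof (intro conjI ballI)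
    fix u v assume uv: "u \<in> carrier G1" "v \<in> carrier G1"
    then have "f u \<in> carrier G2" "f v \<in> carrier G2" using bij_betwE[OF bij] by auto
    then show "inv\<^bsub>G1\<^esub> u \<otimes>\<^bsub>G1\<^esub> v \<in> S1 \<longleftrightarrow> inv\<^bsub>G2\<^esub> (f u) \<otimes>\<^bsub>G2\<^esub> f v \<in> S2"
      using adj[rule_format, OF uv] G1.arcs_ends_cayley_graph_iff[OF S1 uv]
        G2.arcs_ends_cayley_graph_iff[OF S2] by simp
  qed (rule bij)
  have f1: "f \<one>\<^bsub>G1\<^esub> \<in> carrier G2" using cayley_iso_closed[OF f] by simp
  \<comment> \<open>A left translation of \<open>G2\<close> is an automorphism of its Cayley graph;
    it moves the image of the identity to the identity.\<close>
  define \<phi> where "\<phi> x = inv\<^bsub>G2\<^esub> (f \<one>\<^bsub>G1\<^esub>) \<otimes>\<^bsub>G2\<^esub> f x" for x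
  have iso: "cayley_iso G1 S1 G2 S2 \<phi>"
    unfolding \<phi>_def by (rule cayley_iso_comp[OF f G2.cayley_iso_left_mult]) (use f1 in simp)
  have one: "\<phi> \<one>\<^bsub>G1\<^esub> = \<one>\<^bsub>G2\<^esub>" using f1 by (simp add: \<phi>_def)
  obtain n where n: "lower_central G1 n = {\<one>\<^bsub>G1\<^esub>}" using assms(2) by (auto simp: nilpotent_def)
  have "\<phi> \<in> hom G1 G2"
    by (rule cayley_iso_hom[OF assms(1,3) n assms(4,6,5) fin S1 gen S2 iso one])
  then have "\<phi> \<in> iso G1 G2" using iso by (simp add: iso_def cayley_iso_def)
  then show ?thesis by (rule is_isoI)
qed

end
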